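(* Let $p(x)$ be a symmetric nc polynomial of degree $d$ in $g$ symmetric noncommuting variables $x_1,\dots,x_g$. Then $\sigma_-^{min}(p'')\le 1$ if and only if $p$ can be written as $$p(x)=p_0+p_1(x)+p_2(x)+\varphi(x)q(x)+q^T(x)\varphi(x)+\varphi(x)f_0(x)\varphi(x),$$ where (1) each nonzero $p_j(x)$ is a homogeneous symmetric polynomial of degree $j$ ($j=0,1,2$); (2) $\varphi(x)=\sum_{j=1}^g u_jx_j$ is a homogeneous polynomial of degree one and $u$, the vector with components $u_1,\dots,u_g$, is a unit vector in $\mathbb{R}^g$; (3) each of the polynomials $p_2(x)$, $q(x)$, $f_0(x)$ is either $0$ or a homogeneous polynomial of degree two, and the matrix $$E_2=\begin{bmatrix} PQ(p_2)P & PQ(q)^T\\ Q(q)P & Q(f_0)\end{bmatrix}$$ is positive semidefinite, where $P=I_g-uu^T$ is the orthogonal projection onto the orthogonal complement of $u$. If in addition $p$ has degree three, then $f_0=0$ and $q(x)=f_1(x)\varphi(x)$ for some homogeneous polynomial $f_1(x)$ of degree one. Finally, $\sigma_-^{min}(p'')=0$ if and only if $d\le 2$ and $p_2(X)\succeq 0$ for every $n\ge 1$ and every $X\in(\mathbb{R}^{n\times n}_{sym})^g$, where $p_2$ is the homogeneous part of degree two of $p$.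
   Context: An nc polynomial is an element of the free algebra $\mathbb{R}\langle x\rangle$ in noncommuting variables $x_1,\dots,x_g$ with real coefficients. The involution $T$ is the linear map with $x_j^T=x_j$ that reverses words; $p$ is symmetric if $p^T=p$. For a tuple $X=(X_1,\dots,X_g)$ of real symmetric $n\times n$ matrices (i.e. $X\in(\mathbb{R}^{n\times n}_{sym})^g$), $p(X)$ is defined by substitution (a constant $c$ becomes $cI_n$). The Hessian is $p''(x)[h]=\frac{d^2}{dt^2}p(x+th)|_{t=0}$, a polynomial in the $2g$ noncommuting symmetric variables $x_1,\dots,x_g,h_1,\dots,h_g$, homogeneous of degree two in $h$. Every symmetric nc polynomial $f$ has a representation $f=\sum_{j=1}^{\sigma_+}(f_j^+)^Tf_j^+-\sum_{\ell=1}^{\sigma_-}(f_\ell^-)^Tf_\ell^-$ with nc polynomials $f_j^+,f_\ell^-$ in the same variables; $\sigma_-^{min}(f)$ denotes the smallest possible number $\sigma_-$ of negative squares in such a representation. It is applied to $f=p''(x)[h]$ with polynomials in $(x,h)$. For an nc polynomial $q=\sum_{i,j}q_{ij}x_ix_j$ that is homogeneous of degree two (or zero), $Q(q)=[q_{ij}]\in\mathbb{R}^{g\times g}$ denotes its coefficient matrix.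
   Formalization: In the representations defining σ_-^min(p''), the f_j^+ and f_ℓ^- are required to be homogeneous of degree one in h (any degree in x); with arbitrary polynomials σ_-^min ≤ 1 always holds and the first equivalence fails, e.g. for p = -x_1^4. *)

theory Defs
  imports
    "HOL-Analysis.Analysis"
    "HOL-Library.Poly_Mapping"
    "HOL-Library.Extended_Nat"
    "Jordan_Normal_Form.Matrix"
begin

text \<open>The dollar and bullet notations belong to \<^typ>\<open>real ^ 'n\<close> below, not to the
  variable-size matrices of Jordan_Normal_Form.\<close>

no_notation vec_index (infixl \<open>$\<close> 100)
no_notation scalar_prod (infix \<open>\<bullet>\<close> 70)

section \<open>The free algebra\<close>

text \<open>Words form the free monoid under concatenation. With this instance the convolution product
  of \<^typ>\<open>'a list \<Rightarrow>\<^sub>0 real\<close> is the product of the free algebra. The number \<open>g \<ge> 1\<close> of variables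
  is \<open>CARD('g)\<close> for a finite type \<open>'g\<close> of variables.\<close>

instantiation list :: (type) monoid_add
begin

definition zero_list :: "'a list" where "zero_list = []"

definition plus_list :: "'a list \<Rightarrow> 'a list \<Rightarrow> 'a list" where "plus_list = (@)"

instance
  by standard (simp_all add: zero_list_def plus_list_def)

end

type_synonym 'a nc_poly = "'a list \<Rightarrow>\<^sub>0 real"

definition nc_const :: "real \<Rightarrow> 'a nc_poly" where
  "nc_const c = Poly_Mapping.single [] c"

definition nc_var :: "'a \<Rightarrow> 'a nc_poly" where
  "nc_var j = Poly_Mapping.single [j] 1"

definition nc_adjoint :: "'a nc_poly \<Rightarrow> 'a nc_poly" where
  "nc_adjoint p = Poly_Mapping.map_key rev p"

definition nc_symmetric :: "'a nc_poly \<Rightarrow> bool" where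
  "nc_symmetric p \<longleftrightarrow> nc_adjoint p = p"

text \<open>The zero polynomial gets degree 0, and it is homogeneous of every degree.\<close>

definition nc_degree :: "'a nc_poly \<Rightarrow> nat" where
  "nc_degree p = Max (insert 0 (length ` Poly_Mapping.keys p))"

definition nc_homogeneous :: "nat \<Rightarrow> 'a nc_poly \<Rightarrow> bool" where
  "nc_homogeneous k p \<longleftrightarrow> (\<forall>w \<in> Poly_Mapping.keys p. length w = k)"

definition nc_hom_part :: "nat \<Rightarrow> 'a nc_poly \<Rightarrow> 'a nc_poly" where
  "nc_hom_part k p =
     (\<Sum>w \<in> {w \<in> Poly_Mapping.keys p. length w = k}.
        Poly_Mapping.single w (Poly_Mapping.lookup p w))"

definition nc_subst :: "('a \<Rightarrow> 'b nc_poly) \<Rightarrow> 'a nc_poly \<Rightarrow> 'b nc_poly" where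
  "nc_subst s p =
     (\<Sum>w \<in> Poly_Mapping.keys p. nc_const (Poly_Mapping.lookup p w) * prod_list (map s w))"


section \<open>The Hessian\<close>

text \<open>In \<^typ>\<open>('g + 'g) nc_poly\<close> the variable \<open>x\<^sub>j\<close> is \<^term>\<open>Inl j\<close> and \<open>h\<^sub>j\<close> is \<^term>\<open>Inr j\<close>.\<close>

definition nc_shift :: "real \<Rightarrow> 'g nc_poly \<Rightarrow> ('g + 'g) nc_poly" where
  "nc_shift t p = nc_subst (\<lambda>j. nc_var (Inl j) + nc_const t * nc_var (Inr j)) p"

text \<open>The derivative in \<open>t\<close> of \<open>p(x + t h)\<close> is taken coefficientwise; lemma \<open>lookup_nc_hessian\<close> below
  shows that the result has finite support.\<close>

definition nc_hessian :: "'g nc_poly \<Rightarrow> ('g + 'g) nc_poly" where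
  "nc_hessian p =
     Abs_poly_mapping (\<lambda>w. (deriv ^^ 2) (\<lambda>t. Poly_Mapping.lookup (nc_shift t p) w) 0)"

lemma keys_linear_word:
  "v \<in> Poly_Mapping.keys (prod_list (map (\<lambda>j. nc_var (Inl j) + nc_const t * nc_var (Inr j)) w))
   \<Longrightarrow> map (case_sum id id) v = w"
proof (induction w arbitrary: v)
  case Nil
  then show ?case by (simp add: zero_list_def)
next
  case (Cons j w)
  from Cons.prems obtain a b where ab: "v = a + b"
      "a \<in> Poly_Mapping.keys (nc_var (Inl j) + nc_const t * nc_var (Inr j))"
      "b \<in> Poly_Mapping.keys
        (prod_list (map (\<lambda>j. nc_var (Inl j) + nc_const t * nc_var (Inr j)) w))"
    using keys_mult by fastforce
  have "nc_const t * nc_var (Inr j) = (Poly_Mapping.single [Inr j] t :: ('a + 'a) nc_poly)"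
    by (simp add: nc_const_def nc_var_def mult_single plus_list_def)
  with ab(2) have "a = [Inl j] \<or> a = [Inr j]"
    using keys_add[of "nc_var (Inl j) :: ('a + 'a) nc_poly" "nc_const t * nc_var (Inr j)"]
    by (auto simp: nc_var_def split: if_splits)
  with Cons.IH[OF ab(3)] ab(1) show ?case by (auto simp: plus_list_def)
qed

lemma keys_nc_shift:
  assumes "v \<in> Poly_Mapping.keys (nc_shift t p)"
  shows "map (case_sum id id) v \<in> Poly_Mapping.keys p"
proof -
  obtain w where w: "w \<in> Poly_Mapping.keys p"
      "v \<in> Poly_Mapping.keys (nc_const (Poly_Mapping.lookup p w) *
         prod_list (map (\<lambda>j. nc_var (Inl j) + nc_const t * nc_var (Inr j)) w))"
    using assms keys_sum unfolding nc_shift_def nc_subst_def by fast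
  then obtain a b where ab: "v = a + b"
      "a \<in> Poly_Mapping.keys (nc_const (Poly_Mapping.lookup p w) :: ('a + 'a) nc_poly)"
      "b \<in> Poly_Mapping.keys
        (prod_list (map (\<lambda>j. nc_var (Inl j) + nc_const t * nc_var (Inr j)) w))"
    using keys_mult by fastforce
  from ab(2) have "a = []" by (auto simp: nc_const_def split: if_splits)
  with ab(1) keys_linear_word[OF ab(3)] w(1) show ?thesis by (simp add: plus_list_def)
qed

lemma finite_words_over:
  assumes "finite W"
  shows "finite {v. map (case_sum id id) v \<in> W}"
proof (rule finite_subset)
  let ?A = "\<Union>(set ` W)"
  show "{v. map (case_sum id id) v \<in> W}
      \<subseteq> (\<Union>n \<in> length ` W. {v. set v \<subseteq> Inl ` ?A \<union> Inr ` ?A \<and> length v = n})"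
  proof
    fix v :: "('a + 'a) list"
    assume "v \<in> {v. map (case_sum id id) v \<in> W}"
    then have v: "map (case_sum id id) v \<in> W" by simp
    have "s \<in> Inl ` ?A \<union> Inr ` ?A" if "s \<in> set v" for s
    proof -
      have "case_sum id id s \<in> set (map (case_sum id id) v)" using that by simp
      then have "case_sum id id s \<in> ?A" using v by blast
      then show ?thesis by (cases s) auto
    qed
    moreover have "length v \<in> length ` W"
      using imageI[OF v, of length] by simp
    ultimately show "v \<in> (\<Union>n \<in> length ` W. {v. set v \<subseteq> Inl ` ?A \<union> Inr ` ?A \<and> length v = n})"
      by blast
  qed
  show "finite (\<Union>n \<in> length ` W. {v. set v \<subseteq> Inl ` ?A \<union> Inr ` ?A \<and> length v = n})"
    using assms by (auto intro: finite_lists_length_eq)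
qed

lemma lookup_nc_hessian:
  "Poly_Mapping.lookup (nc_hessian p) w =
     (deriv ^^ 2) (\<lambda>t. Poly_Mapping.lookup (nc_shift t p) w) 0"
proof -
  have "finite {w. (deriv ^^ 2) (\<lambda>t. Poly_Mapping.lookup (nc_shift t p) w) 0 \<noteq> 0}"
  proof (rule finite_subset)
    show "finite {v. map (case_sum id id) v \<in> Poly_Mapping.keys p}"
      by (simp add: finite_words_over)
    show "{w. (deriv ^^ 2) (\<lambda>t. Poly_Mapping.lookup (nc_shift t p) w) 0 \<noteq> 0}
        \<subseteq> {v. map (case_sum id id) v \<in> Poly_Mapping.keys p}"
    proof (rule subsetI, rule ccontr)
      fix w
      assume w: "w \<in> {w. (deriv ^^ 2) (\<lambda>t. Poly_Mapping.lookup (nc_shift t p) w) 0 \<noteq> 0}"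
        and "w \<notin> {v. map (case_sum id id) v \<in> Poly_Mapping.keys p}"
      then have "Poly_Mapping.lookup (nc_shift t p) w = 0" for t
        using keys_nc_shift[of w t p] by (auto simp: in_keys_iff)
      then show False using w by (simp add: numeral_2_eq_2)
    qed
  qed
  then show ?thesis by (simp add: nc_hessian_def)
qed


section \<open>Sums and differences of squares\<close>

text \<open>The minimal number of negative squares in a representation
  \<open>f = \<Sum> (f\<^sub>j\<^sup>+)\<^sup>T f\<^sub>j\<^sup>+ - \<Sum> (f\<^sub>l\<^sup>-)\<^sup>T f\<^sub>l\<^sup>-\<close> whose squares are built from polynomials in \<open>S\<close>
  (it is \<open>\<infinity>\<close> if there is no such representation).\<close>

definition sds_over :: "'a nc_poly set \<Rightarrow> 'a nc_poly list \<Rightarrow> 'a nc_poly list \<Rightarrow> 'a nc_poly \<Rightarrow> bool"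
where
  "sds_over S ps ns f \<longleftrightarrow> set ps \<subseteq> S \<and> set ns \<subseteq> S \<and>
     f = (\<Sum>a\<leftarrow>ps. nc_adjoint a * a) - (\<Sum>b\<leftarrow>ns. nc_adjoint b * b)"

definition sigma_minus_min_over :: "'a nc_poly set \<Rightarrow> 'a nc_poly \<Rightarrow> enat" where
  "sigma_minus_min_over S f = Inf {enat (length ns) | ps ns. sds_over S ps ns f}"

text \<open>Without any restriction on the squares the count carries no information: a symmetric \<open>f\<close> is
  \<open>((f + 1)/2)\<^sup>T ((f + 1)/2) - ((f - 1)/2)\<^sup>T ((f - 1)/2)\<close>.\<close>

lemma nc_adjoint_add: "nc_adjoint (a + b) = nc_adjoint a + nc_adjoint b"
  by (simp add: nc_adjoint_def map_key_plus)

lemma nc_adjoint_const [simp]: "nc_adjoint (nc_const c) = nc_const c"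
  using map_key_single[of rev "[]" c] by (simp add: nc_adjoint_def nc_const_def)

lemma nc_poly_induct [case_names zero add]:
  assumes "P 0" and "\<And>a w c. P a \<Longrightarrow> P (a + Poly_Mapping.single w c)"
  shows "P (p :: 'a nc_poly)"
proof (induction p rule: update_induct)
  case const
  show ?case using assms(1) by simp
next
  case (update f a b)
  have "Poly_Mapping.update a b f = f + Poly_Mapping.single a b"
    using update by (intro poly_mapping_eqI)
      (auto simp: lookup_update lookup_add lookup_single when_def in_keys_iff)
  with assms(2) update show ?case by simp
qed

lemma nc_const_mult_commute: "nc_const c * a = a * nc_const c"
proof (induction a rule: nc_poly_induct)
  case zero
  show ?case by simp
next
  case (add a w v)
  then show ?case
    by (simp add: nc_const_def mult_single plus_list_def distrib_left distrib_right mult.commute)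
qed

lemma nc_adjoint_const_mult: "nc_adjoint (nc_const c * a) = nc_const c * nc_adjoint a"
proof (induction a rule: nc_poly_induct)
  case zero
  show ?case by (simp add: nc_adjoint_def)
next
  case (add a w v)
  have "nc_adjoint (Poly_Mapping.single u r) = Poly_Mapping.single (rev u) r" for u :: "'a list" and r
    using map_key_single[of rev "rev u" r] by (simp add: nc_adjoint_def)
  with add show ?case
    by (simp add: nc_const_def mult_single plus_list_def distrib_left nc_adjoint_add)
qed

lemma sigma_minus_min_over_UNIV_le_1:
  assumes "nc_symmetric f"
  shows "sigma_minus_min_over UNIV f \<le> 1"
proof -
  let ?h = "nc_const (1/2) :: 'a nc_poly"
  let ?a = "?h * (f + nc_const 1)" and ?b = "?h * (f + nc_const (- 1))"
  have c1: "nc_const 1 = (1 :: 'a nc_poly)"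
    by (simp add: nc_const_def flip: zero_list_def)
  have cm1: "nc_const (- 1) = (- 1 :: 'a nc_poly)"
    by (simp add: c1[symmetric] nc_const_def single_uminus)
  have hh: "?h + ?h = 1"
    by (simp add: c1[symmetric] nc_const_def single_add[symmetric])
  have adj: "nc_adjoint ?a = ?a" "nc_adjoint ?b = ?b"
    using assms by (simp_all add: nc_adjoint_const_mult nc_adjoint_add nc_symmetric_def)
  have fh: "?h * f = f * ?h" "?h * (f * y) = f * (?h * y)" for y
    using nc_const_mult_commute[of "1/2" f] by (simp_all flip: mult.assoc)
  have "?a * ?a - ?b * ?b = (?a + ?b) * (?a - ?b)"
    using fh by (simp add: c1 cm1 algebra_simps)
  also have "?a + ?b = (?h + ?h) * f" by (simp add: c1 cm1 algebra_simps)
  also have "?a - ?b = ?h + ?h" by (simp add: c1 cm1 algebra_simps)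
  finally have "sds_over UNIV [?a] [?b] f" by (simp add: sds_over_def adj hh)
  then have "enat 1 \<in> {enat (length ns) | ps ns. sds_over UNIV ps ns f}"
    by (intro CollectI exI[of _ "[?a]"] exI[of _ "[?b]"]) simp
  then show ?thesis
    unfolding sigma_minus_min_over_def one_enat_def by (rule Inf_lower)
qed

text \<open>For \<open>p''(x)[h]\<close>, which is homogeneous of degree two in \<open>h\<close>, the squares are therefore those of
  polynomials that are homogeneous of degree one in \<open>h\<close> (with no restriction on \<open>x\<close>).\<close>

definition h_linear :: "('g + 'g) nc_poly set" where
  "h_linear = {f. \<forall>w \<in> Poly_Mapping.keys f. length (filter (\<lambda>v. \<not> isl v) w) = 1}"

definition sigma_minus_min_hessian :: "'g nc_poly \<Rightarrow> enat" where
  "sigma_minus_min_hessian p = sigma_minus_min_over h_linear (nc_hessian p)"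


section \<open>Evaluation at tuples of symmetric matrices\<close>

definition nc_eval :: "nat \<Rightarrow> ('g \<Rightarrow> real mat) \<Rightarrow> 'g nc_poly \<Rightarrow> real mat" where
  "nc_eval n X p = Matrix.mat n n (\<lambda>ij.
     \<Sum>w \<in> Poly_Mapping.keys p.
       Poly_Mapping.lookup p w * (foldr (\<lambda>j M. X j * M) w (1\<^sub>m n) $$ ij))"

definition sym_mats :: "nat \<Rightarrow> real mat set" where
  "sym_mats n = {A \<in> carrier_mat n n. A\<^sup>T = A}"

definition psd_mat :: "nat \<Rightarrow> real mat \<Rightarrow> bool" where
  "psd_mat n A \<longleftrightarrow> A \<in> sym_mats n \<and> (\<forall>v \<in> carrier_vec n. 0 \<le> scalar_prod v (A *\<^sub>v v))"


section \<open>The canonical form\<close>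

definition psd_matrix :: "real ^ 'n ^ 'n \<Rightarrow> bool" where
  "psd_matrix A \<longleftrightarrow> transpose A = A \<and> (\<forall>v. 0 \<le> v \<bullet> (A *v v))"

definition coeff_matrix :: "'g::finite nc_poly \<Rightarrow> real ^ 'g ^ 'g" where
  "coeff_matrix q = (\<chi> i j. Poly_Mapping.lookup q [i, j])"

definition linear_form :: "real ^ 'g \<Rightarrow> 'g::finite nc_poly" where
  "linear_form u = (\<Sum>j\<in>UNIV. nc_const (u $ j) * nc_var j)"

definition proj_orth :: "real ^ 'g \<Rightarrow> real ^ 'g ^ 'g" where
  "proj_orth u = Finite_Cartesian_Product.mat 1 - (\<chi> i j. u $ i * u $ j)"

definition block_matrix ::
  "real ^ 'g ^ 'g \<Rightarrow> real ^ 'g ^ 'g \<Rightarrow> real ^ 'g ^ 'g \<Rightarrow> real ^ 'g ^ 'g \<Rightarrow> real ^ ('g + 'g) ^ ('g + 'g)"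
where
  "block_matrix A B C D = (\<chi> r s. case (r, s) of
      (Inl i, Inl j) \<Rightarrow> A $ i $ j
    | (Inl i, Inr j) \<Rightarrow> B $ i $ j
    | (Inr i, Inl j) \<Rightarrow> C $ i $ j
    | (Inr i, Inr j) \<Rightarrow> D $ i $ j)"

definition E2 :: "real ^ 'g \<Rightarrow> 'g::finite nc_poly \<Rightarrow> 'g nc_poly \<Rightarrow> 'g nc_poly \<Rightarrow> real ^ ('g + 'g) ^ ('g + 'g)"
where
  "E2 u p2 q f0 = (let P = proj_orth u in
     block_matrix
       (P ** coeff_matrix p2 ** P)  (P ** transpose (coeff_matrix q))
       (coeff_matrix q ** P)        (coeff_matrix f0))"

definition canonical_form ::
  "'g::finite nc_poly \<Rightarrow> real ^ 'g \<Rightarrow> 'g nc_poly \<Rightarrow> 'g nc_poly \<Rightarrow> 'g nc_poly \<Rightarrow> 'g nc_poly \<Rightarrow>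
    'g nc_poly \<Rightarrow> bool"
where
  "canonical_form p u p0 p1 p2 q f0 \<longleftrightarrow>
     (let \<phi> = linear_form u in
        p = p0 + p1 + p2 + \<phi> * q + nc_adjoint q * \<phi> + \<phi> * f0 * \<phi>) \<and>
     nc_homogeneous 0 p0 \<and> nc_symmetric p0 \<and>
     nc_homogeneous 1 p1 \<and> nc_symmetric p1 \<and>
     nc_homogeneous 2 p2 \<and> nc_symmetric p2 \<and>
     norm u = 1 \<and>
     nc_homogeneous 2 q \<and> nc_homogeneous 2 f0 \<and>
     psd_matrix (E2 u p2 q f0)"

end

theory Submission
  imports Defs
begin

text \<open>For nonempty words \<open>v = j \<beta>\<close> and \<open>w = k \<beta>'\<close> the coefficient of \<open>\<beta>\<^sup>T h\<^sub>j h\<^sub>k \<beta>'\<close> in \<open>p''\<close> is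
  twice the coefficient of \<open>v\<^sup>T w\<close> in \<open>p\<close>, while in a square \<open>a\<^sup>T a\<close> of an \<open>h\<close>-linear \<open>a\<close> it is a product
  of two coefficients of \<open>a\<close>. Hence a representation of \<open>p''\<close> with one negative square makes the Hankel
  form \<open>(v, w) \<mapsto> p\<^bsub>v\<^sup>T w\<^esub>\<close> positive semidefinite on a hyperplane, which can be taken to be the normal
  hyperplane of a unit vector \<open>u\<close> in the words of length one. Long words are isotropic for this form, so
  they lie in its radical; this bounds the degree by four, makes \<open>\<phi>\<close> a factor of the top parts, and
  what remains of the form is the quadratic form of \<open>E2\<close>. Conversely, \<open>p''\<close> is the Gram form of \<open>E2\<close> plus terms
  with \<open>\<phi>(h)\<close> as an outer factor, and \<open>2 (a\<^sup>T b + b\<^sup>T a) = (a + b)\<^sup>T (a + b) - (a - b)\<^sup>T (a - b)\<close>.\<close>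

section \<open>Coefficients in the free algebra\<close>

text \<open>The Hankel form is half of the scalar middle matrix of the Hessian: \<open>p''\<close>
  is written in the border entries \<open>h\<^sub>j \<beta>(x)\<close>, and the terms with an
  \<open>x\<close> between the two letters \<open>h\<close> are dropped. No coefficient of
  \<open>p\<close> at a word of length at least two is lost, since such a word can be cut as
  \<open>v\<^sup>T w\<close> at any inner place. This freedom drives the argument: the same
  coefficient is an entry of the form in several positions, and one of them may lie where the form
  degenerates. A word of length k is isotropic as soon as 2 k > d. If the form is nonnegative
  everywhere, cutting after one letter gives d \<le> 2; if only on a hyperplane that constrains the
  single letters, the short factor must have two letters, which gives d \<le> 4. The obstacle is
  that the functional of the negative square sees words of every length, whereas \<open>u\<close>
  has to live on single letters. Nonnegativity says nothing about the direction of \<open>u\<close>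
  itself, which is why \<open>E2\<close> is compressed by \<open>P\<close> on its first
  block.\<close>

abbreviation coeff :: "'a nc_poly \<Rightarrow> 'a list \<Rightarrow> real" where
  "coeff \<equiv> Poly_Mapping.lookup"

lemma sum_splits_of_append:
  "(\<Sum>k\<le>length w. (if x = take k w then r else 0) * (if y = drop k w then s else 0)) =
     (if x @ y = w then r * s else (0 :: real))"
proof -
  have eq: "(if x = take k w then r else 0) * (if y = drop k w then s else 0) =
      (if k = length x then if x @ y = w then r * s else 0 else 0)" if "k \<le> length w" for k
  proof (cases "k = length x")
    case True
    have "x = take k w \<and> y = drop k w \<longleftrightarrow> x @ y = w"
      using True that by (auto simp: append_eq_conv_conj)
    with True show ?thesis by auto
  next
    case False
    then have "x \<noteq> take k w" using that by auto
    with False show ?thesis by simp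
  qed
  have "(\<Sum>k\<le>length w. (if x = take k w then r else 0) * (if y = drop k w then s else 0)) =
      (\<Sum>k\<le>length w. if k = length x then if x @ y = w then r * s else 0 else 0)"
    by (rule sum.cong) (use eq in auto)
  then show ?thesis by auto
qed

text \<open>By bilinearity two monomials suffice, and for them exactly one cut contributes. All
  later products are computed through this sum over cuts.\<close>

lemma coeff_mult:
  "coeff (a * b) w = (\<Sum>k\<le>length w. coeff a (take k w) * coeff b (drop k w))"
proof (induction a rule: nc_poly_induct)
  case (add a x r)
  have "coeff (Poly_Mapping.single x r * b) w =
      (\<Sum>k\<le>length w. coeff (Poly_Mapping.single x r) (take k w) * coeff b (drop k w))"
  proof (induction b rule: nc_poly_induct)
    case (add b y s)
    then show ?case
      using sum_splits_of_append[of x w r y s]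
      by (simp add: distrib_left lookup_add mult_single plus_list_def sum.distrib lookup_single
          when_def)
  qed simp
  with add show ?case
    by (simp add: distrib_right lookup_add sum.distrib)
qed simp

lemma coeff_const: "coeff (nc_const c) w = (if w = [] then c else 0)"
  by (simp add: nc_const_def lookup_single when_def)

lemma coeff_const_mult [simp]: "coeff (nc_const c * a) w = c * coeff a w"
proof -
  have "(\<Sum>k\<le>length w. coeff (nc_const c) (take k w) * coeff a (drop k w)) =
      (\<Sum>k\<le>length w. if k = 0 then c * coeff a w else 0)"
    by (rule sum.cong) (auto simp: coeff_const)
  then show ?thesis by (simp add: coeff_mult)
qed

lemma coeff_adjoint [simp]: "coeff (nc_adjoint a) w = coeff a (rev w)"
  by (simp add: nc_adjoint_def map_key.rep_eq)

lemma coeff_var: "coeff (nc_var j) w = (if w = [j] then 1 else 0)"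
  by (auto simp: nc_var_def lookup_single when_def)

lemma nc_adjoint_adjoint [simp]: "nc_adjoint (nc_adjoint a) = a"
  by (rule poly_mapping_eqI) simp

lemma nc_adjoint_zero [simp]: "nc_adjoint 0 = 0"
  by (rule poly_mapping_eqI) simp

lemma nc_adjoint_diff: "nc_adjoint (a - b) = nc_adjoint a - nc_adjoint b"
  by (rule poly_mapping_eqI) (simp add: lookup_minus)

lemma nc_adjoint_sum: "nc_adjoint (sum f I) = (\<Sum>i\<in>I. nc_adjoint (f i))"
  by (rule poly_mapping_eqI) (simp add: lookup_sum)

lemma nc_adjoint_var [simp]: "nc_adjoint (nc_var j) = nc_var j"
  by (rule poly_mapping_eqI) (auto simp: coeff_var)

lemma nc_adjoint_mult: "nc_adjoint (a * b) = nc_adjoint b * nc_adjoint a"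
proof (rule poly_mapping_eqI)
  fix w
  have "coeff (nc_adjoint (a * b)) w =
      (\<Sum>k\<le>length w. coeff a (take k (rev w)) * coeff b (drop k (rev w)))"
    by (simp add: coeff_mult)
  \<comment> \<open>Reversal moves a cut at \<open>k\<close> to \<open>length w - k\<close>.\<close>
  also have "\<dots> = (\<Sum>k\<le>length w. coeff a (take (length w - k) (rev w)) * coeff b (drop (length w - k) (rev w)))"
    by (rule sum.reindex_bij_witness[of _ "\<lambda>k. length w - k" "\<lambda>k. length w - k"]) auto
  also have "\<dots> = coeff (nc_adjoint b * nc_adjoint a) w"
    unfolding coeff_mult by (rule sum.cong) (auto simp: take_rev drop_rev)
  finally show "coeff (nc_adjoint (a * b)) w = coeff (nc_adjoint b * nc_adjoint a) w" .
qed

lemma coeff_var_mult: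
  "coeff (nc_var j * a) w = (case w of [] \<Rightarrow> 0 | i # v \<Rightarrow> if i = j then coeff a v else 0)"
proof -
  have "(\<Sum>k\<le>length w. coeff (nc_var j) (take k w) * coeff a (drop k w)) =
      (\<Sum>k\<le>length w. if k = 1 then if take 1 w = [j] then coeff a (drop 1 w) else 0 else 0)"
    by (rule sum.cong) (auto simp: coeff_var take_eq_Nil dest: arg_cong[of "take _ w" _ length])
  then show ?thesis by (auto simp: coeff_mult split: list.split)
qed

lemma coeff_linear_form:
  "coeff (linear_form u) w = (case w of [i] \<Rightarrow> u $ i | _ \<Rightarrow> 0)"
proof (cases "length w = 1")
  case True
  then obtain i where "w = [i]" by (auto simp: length_Suc_conv)
  then show ?thesis by (auto simp: linear_form_def lookup_sum coeff_var sum.delta if_distrib cong: if_cong)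
next
  case False
  then show ?thesis by (auto simp: linear_form_def lookup_sum coeff_var split: list.split)
qed

lemma coeff_linear_form_mult:
  "coeff (linear_form u * a) w = (case w of [] \<Rightarrow> 0 | i # v \<Rightarrow> u $ i * coeff a v)"
  by (cases w) (auto simp: linear_form_def sum_distrib_right lookup_sum mult.assoc coeff_var_mult
      if_distrib cong: if_cong)

lemma nc_adjoint_linear_form [simp]: "nc_adjoint (linear_form u) = linear_form u"
  by (simp add: linear_form_def nc_adjoint_sum nc_adjoint_const_mult)

lemma coeff_mult_linear_form:
  "coeff (a * linear_form u) w = (if w = [] then 0 else coeff a (butlast w) * u $ last w)"
proof -
  have "a * linear_form u = nc_adjoint (linear_form u * nc_adjoint a)"
    by (simp add: nc_adjoint_mult)
  then have "coeff (a * linear_form u) w = coeff (linear_form u * nc_adjoint a) (rev w)"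
    by simp
  also have "\<dots> = (if w = [] then 0 else coeff a (butlast w) * u $ last w)"
    by (cases w rule: rev_cases) (simp_all add: coeff_linear_form_mult)
  finally show ?thesis .
qed

lemma coeff_hom_part: "coeff (nc_hom_part k p) w = (if length w = k then coeff p w else 0)"
proof -
  have fin: "finite {w \<in> Poly_Mapping.keys p. length w = k}" by simp
  have "coeff (nc_hom_part k p) w =
      (\<Sum>v\<in>{w \<in> Poly_Mapping.keys p. length w = k}. if v = w then coeff p v else 0)"
    by (simp add: nc_hom_part_def lookup_sum lookup_single when_def)
  also have "\<dots> = (if w \<in> {w \<in> Poly_Mapping.keys p. length w = k} then coeff p w else 0)"
    by (subst sum.delta[OF fin]) simp
  finally show ?thesis by (auto simp: in_keys_iff)
qed

lemma nc_homogeneous_iff: "nc_homogeneous k p \<longleftrightarrow> (\<forall>w. coeff p w \<noteq> 0 \<longrightarrow> length w = k)"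
  by (auto simp: nc_homogeneous_def in_keys_iff)

lemma nc_symmetric_iff: "nc_symmetric p \<longleftrightarrow> (\<forall>w. coeff p (rev w) = coeff p w)"
  by (simp add: nc_symmetric_def poly_mapping_eq_iff fun_eq_iff)

lemma coeff_beyond_degree: "nc_degree p < length w \<Longrightarrow> coeff p w = 0"
  by (rule ccontr) (auto simp: nc_degree_def in_keys_iff)

lemma degree_attained:
  assumes "0 < nc_degree p"
  obtains w where "length w = nc_degree p" "coeff p w \<noteq> 0"
proof -
  have "nc_degree p \<in> insert 0 (length ` Poly_Mapping.keys p)"
    unfolding nc_degree_def by (rule Max_in) auto
  with assms that show ?thesis by (auto simp: in_keys_iff)
qed

section \<open>The Hessian\<close>

abbreviation merge :: "('g + 'g) list \<Rightarrow> 'g list" where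
  "merge \<equiv> map (case_sum id id)"

abbreviation h_count :: "('g + 'g) list \<Rightarrow> nat" where
  "h_count w \<equiv> length (filter (\<lambda>v. \<not> isl v) w)"

text \<open>The part of \<open>p(x + h)\<close> that is homogeneous of degree \<open>k\<close> in \<open>h\<close>.\<close>

definition polar :: "nat \<Rightarrow> 'g nc_poly \<Rightarrow> ('g + 'g) nc_poly" where
  "polar k p = Abs_poly_mapping (\<lambda>w. if h_count w = k then coeff p (merge w) else 0)"

lemma coeff_polar: "coeff (polar k p) w = (if h_count w = k then coeff p (merge w) else 0)"
proof -
  have "finite {w. (if h_count w = k then coeff p (merge w) else 0) \<noteq> 0}"
    by (rule finite_subset[OF _ finite_words_over[of "Poly_Mapping.keys p"]])
      (auto simp: in_keys_iff)
  then show ?thesis by (simp add: polar_def)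
qed

lemma coeff_subst_shift_word:
  "coeff (prod_list (map (\<lambda>j. nc_var (Inl j) + nc_const t * nc_var (Inr j)) w)) v =
     (if merge v = w then t ^ h_count v else 0)"
proof (induction w arbitrary: v)
  case Nil
  show ?case by (auto simp: zero_list_def lookup_one when_def)
next
  case (Cons j w)
  then show ?case
    by (cases v)
      (auto simp: distrib_right lookup_add mult.assoc coeff_var_mult split: sum.split)
qed

lemma coeff_shift: "coeff (nc_shift t p) v = t ^ h_count v * coeff p (merge v)"
proof -
  have "coeff (nc_shift t p) v =
      (\<Sum>w\<in>Poly_Mapping.keys p. if merge v = w then coeff p w * t ^ h_count v else 0)"
    unfolding nc_shift_def nc_subst_def lookup_sum coeff_const_mult coeff_subst_shift_word
    by (rule sum.cong) auto
  also have "\<dots> = (if merge v \<in> Poly_Mapping.keys p then coeff p (merge v) * t ^ h_count v else 0)"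
    by (rule sum.delta') simp
  finally show ?thesis by (auto simp: in_keys_iff)
qed

lemma second_deriv_monomial:
  "(deriv ^^ 2) (\<lambda>t::real. t ^ k * c) 0 = (if k = 2 then 2 * c else 0)"
proof -
  have d: "deriv (\<lambda>t::real. t ^ k * c) = (\<lambda>t. real k * t ^ (k - 1) * c)" for k c
    by (rule ext, rule DERIV_imp_deriv) (auto intro!: derivative_eq_intros)
  have "deriv (\<lambda>t. real k * t ^ (k - 1) * c) = deriv (\<lambda>t. t ^ (k - 1) * (real k * c))"
    by (simp add: mult_ac)
  also have "\<dots> = (\<lambda>t. real (k - 1) * t ^ (k - 1 - 1) * (real k * c))"
    by (rule d)
  finally show ?thesis
    by (auto simp: numeral_2_eq_2 d power_0_left)
qed

text \<open>From here on no derivative occurs: the Hessian is read off from the coefficients of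
  \<open>p\<close> at merged words.\<close>

lemma nc_hessian_eq_polar: "nc_hessian p = nc_const 2 * polar 2 p"
  by (rule poly_mapping_eqI)
    (simp add: lookup_nc_hessian coeff_shift second_deriv_monomial coeff_polar)

lemma polar_add: "polar k (a + b) = polar k a + polar k b"
  by (rule poly_mapping_eqI) (simp add: coeff_polar lookup_add)

lemma polar_sum: "polar k (sum f I) = (\<Sum>i\<in>I. polar k (f i))"
  by (rule poly_mapping_eqI) (simp add: coeff_polar lookup_sum)

lemma polar_const_mult: "polar k (nc_const c * a) = nc_const c * polar k a"
  by (rule poly_mapping_eqI) (simp add: coeff_polar)

lemma polar_adjoint: "polar k (nc_adjoint a) = nc_adjoint (polar k a)"
  by (rule poly_mapping_eqI) (simp add: coeff_polar rev_map flip: rev_filter)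

text \<open>Substituting \<open>x + h\<close> for \<open>x\<close> is multiplicative and
  \<open>polar\<close> extracts the components by degree in \<open>h\<close>, so this is the Leibniz
  rule without binomial coefficients.\<close>

lemma polar_mult: "polar k (a * b) = (\<Sum>i\<le>k. polar i a * polar (k - i) b)"
proof (rule poly_mapping_eqI)
  fix w :: "('a + 'a) list"
  have inner: "(\<Sum>i\<le>k. coeff (polar i a) (take n w) * coeff (polar (k - i) b) (drop n w)) =
      (if h_count w = k then coeff a (merge (take n w)) * coeff b (merge (drop n w)) else 0)" for n
  proof -
    have "h_count w = h_count (take n w) + h_count (drop n w)"
      by (simp flip: length_append filter_append)
    then have "coeff (polar i a) (take n w) * coeff (polar (k - i) b) (drop n w) =
        (if i = h_count (take n w) then (if h_count w = k then
           coeff a (merge (take n w)) * coeff b (merge (drop n w)) else 0) else 0)" if "i \<le> k" for i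
      using that by (auto simp: coeff_polar)
    then have "(\<Sum>i\<le>k. coeff (polar i a) (take n w) * coeff (polar (k - i) b) (drop n w)) =
        (\<Sum>i\<le>k. if i = h_count (take n w) then (if h_count w = k then
           coeff a (merge (take n w)) * coeff b (merge (drop n w)) else 0) else 0)"
      by (intro sum.cong) auto
    then show ?thesis using \<open>h_count w = _\<close> by auto
  qed
  have "coeff (\<Sum>i\<le>k. polar i a * polar (k - i) b) w =
      (\<Sum>n\<le>length w. \<Sum>i\<le>k. coeff (polar i a) (take n w) * coeff (polar (k - i) b) (drop n w))"
    unfolding lookup_sum coeff_mult by (rule sum.swap)
  also have "\<dots> = coeff (polar k (a * b)) w"
    unfolding inner by (auto simp: coeff_polar coeff_mult take_map drop_map)
  finally show "coeff (polar k (a * b)) w = coeff (\<Sum>i\<le>k. polar i a * polar (k - i) b) w" ..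
qed

lemma polar_eq_0:
  assumes "nc_homogeneous m a" "m < k"
  shows "polar k a = 0"
proof (rule poly_mapping_eqI)
  fix w :: "('a + 'a) list"
  have "coeff a (merge w) = 0" if "h_count w = k"
    using that assms length_filter_le[of "\<lambda>v. \<not> isl v" w]
    by (metis leD length_map nc_homogeneous_iff)
  then show "coeff (polar k a) w = coeff 0 w"
    by (simp add: coeff_polar)
qed

section \<open>The Hankel form of a polynomial\<close>

text \<open>The infimum of a nonempty set in \<open>enat\<close> is attained, and that of the empty
  set is infinite, hence not below \<open>enat k\<close>.\<close>

lemma sigma_minus_min_over_le_iff:
  "sigma_minus_min_over S f \<le> enat k \<longleftrightarrow> (\<exists>ps ns. length ns \<le> k \<and> sds_over S ps ns f)"
proof
  let ?A = "{enat (length ns) | ps ns. sds_over S ps ns f}"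
  assume le: "sigma_minus_min_over S f \<le> enat k"
  then have "?A \<noteq> {}"
    by (auto simp: sigma_minus_min_over_def Inf_enat_def split: if_splits)
  then have "Inf ?A \<in> ?A"
    unfolding Inf_enat_def by (metis (mono_tags, lifting) LeastI ex_in_conv)
  then obtain ps ns where "Inf ?A = enat (length ns)" "sds_over S ps ns f" by blast
  moreover from this le have "length ns \<le> k" by (simp add: sigma_minus_min_over_def)
  ultimately show "\<exists>ps ns. length ns \<le> k \<and> sds_over S ps ns f" by blast
next
  assume "\<exists>ps ns. length ns \<le> k \<and> sds_over S ps ns f"
  then obtain ps ns where "length ns \<le> k" "sds_over S ps ns f" by blast
  then show "sigma_minus_min_over S f \<le> enat k"
    unfolding sigma_minus_min_over_def by (intro Inf_lower2[of "enat (length ns)"]) auto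
qed

text \<open>The letter \<open>h\<close> comes first so that reversing the left factor brings the two
  letters \<open>h\<close> together. At \<open>[]\<close> the value is meaningless because of
  \<open>hd\<close>, so only nonempty words serve as indices.\<close>

definition mark :: "'g list \<Rightarrow> ('g + 'g) list" where
  "mark u = Inr (hd u) # map Inl (tl u)"

lemma h_count_Inl [simp]: "h_count (map Inl w) = 0" "h_count (take k (map Inl w)) = 0"
    "h_count (rev (map Inl w)) = 0" "h_count (take k (rev (map Inl w))) = 0"
    "h_count (drop k (map Inl w)) = 0"
  by (fastforce simp: filter_empty_conv dest: in_set_takeD in_set_dropD)+

text \<open>In the word \<open>rev (mark u) @ mark v\<close> the two letters \<open>h\<close> are adjacent, so it splits in only one
  way into two words with a single letter \<open>h\<close> each.\<close>

lemma coeff_square_mark: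
  assumes "a \<in> h_linear" "u \<noteq> []" "v \<noteq> []"
  shows "coeff (nc_adjoint a * a) (rev (mark u) @ mark v) = coeff a (mark u) * coeff a (mark v)"
proof -
  let ?W = "rev (mark u) @ mark v"
  have lin: "coeff a w = 0" if "h_count w \<noteq> 1" for w
    using assms(1) that by (auto simp: h_linear_def in_keys_iff)
  have len: "length (mark u) = length u" using assms(2) by (cases u) (auto simp: mark_def)
  \<comment> \<open>An \<open>h\<close>-linear \<open>a\<close> vanishes at words without
    \<open>h\<close>: a cut left of the middle leaves no \<open>h\<close> in the left piece, a cut
    right of it none in the right piece.\<close>
  have "coeff (nc_adjoint a) (take k ?W) * coeff a (drop k ?W) =
      (if k = length u then coeff a (mark u) * coeff a (mark v) else 0)" for k
  proof -
    consider "k < length u" | "k = length u" | "k > length u" by linarith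
    then show ?thesis
    proof cases
      case 1
      then have "take k ?W = take k (rev (map Inl (tl u)))"
        using assms(2) by (cases u) (auto simp: mark_def)
      then have "h_count (rev (take k ?W)) = 0"
        by (simp flip: rev_filter)
      then have "coeff (nc_adjoint a) (take k ?W) = 0"
        by (simp add: lin)
      with 1 show ?thesis by simp
    next
      case 2
      then show ?thesis by (simp add: len)
    next
      case 3
      then have "drop k ?W = drop (k - length u - 1) (map Inl (tl v))"
        by (cases "k - length u") (simp_all add: len, simp_all add: mark_def)
      then have "coeff a (drop k ?W) = 0" by (simp add: lin)
      with 3 show ?thesis by simp
    qed
  qed
  then show ?thesis by (simp add: coeff_mult len)
qed

lemma coeff_hessian_mark:
  assumes "u \<noteq> []" "v \<noteq> []"
  shows "coeff (nc_hessian p) (rev (mark u) @ mark v) = 2 * coeff p (rev u @ v)"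
proof -
  have "merge (rev (mark u) @ mark v) = rev u @ v"
    using assms by (cases u; cases v) (auto simp: mark_def rev_map comp_def)
  moreover have "h_count (rev (mark u) @ mark v) = 2"
    by (simp add: mark_def flip: rev_filter)
  ultimately show ?thesis
    by (simp add: nc_hessian_eq_polar coeff_polar del: map_append filter_append)
qed

lemma coeff_sum_list: "coeff (\<Sum>a\<leftarrow>as. f a) w = (\<Sum>a\<leftarrow>as. coeff (f a) w)"
  by (induction as) (auto simp: lookup_add)

lemma hankel_entry_sds:
  assumes "sds_over h_linear ps ns (nc_hessian p)" "u \<noteq> []" "v \<noteq> []"
  shows "2 * coeff p (rev u @ v) =
    (\<Sum>a\<leftarrow>ps. coeff a (mark u) * coeff a (mark v)) - (\<Sum>b\<leftarrow>ns. coeff b (mark u) * coeff b (mark v))"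
proof -
  have "(\<Sum>a\<leftarrow>as. coeff (nc_adjoint a * a) (rev (mark u) @ mark v)) =
      (\<Sum>a\<leftarrow>as. coeff a (mark u) * coeff a (mark v))" if "set as \<subseteq> h_linear" for as
    using that assms by (intro arg_cong[of _ _ sum_list] map_cong) (auto simp: coeff_square_mark)
  from this[of ps] this[of ns] assms show ?thesis
    unfolding coeff_hessian_mark[OF assms(2,3), symmetric]
    by (simp add: sds_over_def lookup_minus coeff_sum_list)
qed

text \<open>The length bound makes the sums finite; words longer than the degree contribute nothing
  to them. The \<open>+ 2\<close> keeps all words of length one and two present even in degree
  0.\<close>

definition hankel_words :: "'g nc_poly \<Rightarrow> 'g list set" where
  "hankel_words p = {w. w \<noteq> [] \<and> length w \<le> nc_degree p + 2}"

definition hankel :: "'g nc_poly \<Rightarrow> ('g list \<Rightarrow> real) \<Rightarrow> ('g list \<Rightarrow> real) \<Rightarrow> real" where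
  "hankel p y z =
     (\<Sum>u\<in>hankel_words p. \<Sum>v\<in>hankel_words p. y u * z v * coeff p (rev u @ v))"

lemma finite_hankel_words [simp]: "finite (hankel_words (p :: 'g::finite nc_poly))"
  by (rule finite_subset[OF _ finite_lists_length_le[of UNIV "nc_degree p + 2"]])
    (auto simp: hankel_words_def)

text \<open>Each square of a polynomial becomes the square of one linear functional of
  \<open>y\<close>, so the number of negative squares bounds the codimension of a subspace on which
  the form is nonnegative.\<close>

lemma hankel_sds:
  fixes p :: "'g::finite nc_poly"
  assumes "sds_over h_linear ps ns (nc_hessian p)"
  shows "2 * hankel p y y =
    (\<Sum>a\<leftarrow>ps. (\<Sum>u\<in>hankel_words p. coeff a (mark u) * y u)\<^sup>2) -
    (\<Sum>b\<leftarrow>ns. (\<Sum>u\<in>hankel_words p. coeff b (mark u) * y u)\<^sup>2)"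
proof -
  let ?U = "hankel_words p"
  have sq: "(\<Sum>u\<in>?U. \<Sum>v\<in>?U. y u * y v * (\<Sum>a\<leftarrow>as. coeff a (mark u) * coeff a (mark v))) =
      (\<Sum>a\<leftarrow>as. (\<Sum>u\<in>?U. coeff a (mark u) * y u)\<^sup>2)" for as
  proof (induction as)
    case (Cons a as)
    have "(\<Sum>u\<in>?U. \<Sum>v\<in>?U. y u * y v * (coeff a (mark u) * coeff a (mark v))) =
        (\<Sum>u\<in>?U. coeff a (mark u) * y u)\<^sup>2"
      by (simp add: power2_eq_square sum_product mult_ac)
    with Cons show ?case by (simp add: distrib_left sum.distrib)
  qed simp
  have "2 * hankel p y y = (\<Sum>u\<in>?U. \<Sum>v\<in>?U. y u * y v * (2 * coeff p (rev u @ v)))"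
    by (simp add: hankel_def sum_distrib_left mult_ac)
  also have "\<dots> = (\<Sum>u\<in>?U. \<Sum>v\<in>?U. y u * y v *
      ((\<Sum>a\<leftarrow>ps. coeff a (mark u) * coeff a (mark v)) -
       (\<Sum>b\<leftarrow>ns. coeff b (mark u) * coeff b (mark v))))"
    by (intro sum.cong refl) (simp add: hankel_words_def hankel_entry_sds[OF assms])
  finally show ?thesis
    by (simp add: right_diff_distrib sum_subtractf sq)
qed

lemma hankel_nonneg_of_sigma_0:
  fixes p :: "'g::finite nc_poly"
  assumes "sigma_minus_min_hessian p = 0"
  shows "0 \<le> hankel p y y"
proof -
  have "sigma_minus_min_over h_linear (nc_hessian p) \<le> enat 0"
    using assms by (simp add: sigma_minus_min_hessian_def zero_enat_def)
  then obtain ps where "sds_over h_linear ps [] (nc_hessian p)"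
    unfolding sigma_minus_min_over_le_iff by auto
  then have "2 * hankel p y y = (\<Sum>a\<leftarrow>ps. (\<Sum>u\<in>hankel_words p. coeff a (mark u) * y u)\<^sup>2)"
    by (simp add: hankel_sds)
  also have "\<dots> \<ge> 0" by (rule sum_list_nonneg) auto
  finally show ?thesis by simp
qed

lemma hankel_nonneg_of_sigma_le_1:
  fixes p :: "'g::finite nc_poly"
  assumes "sigma_minus_min_hessian p \<le> 1"
  obtains w where "\<And>y. (\<Sum>u\<in>hankel_words p. w u * y u) = 0 \<Longrightarrow> 0 \<le> hankel p y y"
proof -
  have "sigma_minus_min_over h_linear (nc_hessian p) \<le> enat 1"
    using assms by (simp add: sigma_minus_min_hessian_def one_enat_def)
  then obtain ps ns where sds: "sds_over h_linear ps ns (nc_hessian p)" and "length ns \<le> 1"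
    unfolding sigma_minus_min_over_le_iff by auto
  then consider "ns = []" | b where "ns = [b]"
    by (cases ns) auto
  \<comment> \<open>The functional \<open>w = 0\<close> covers the case without a negative
    square.\<close>
  then obtain w where
    w: "\<And>y. (\<Sum>b\<leftarrow>ns. (\<Sum>u\<in>hankel_words p. coeff b (mark u) * y u)\<^sup>2) =
         (\<Sum>u\<in>hankel_words p. w u * y u)\<^sup>2"
  proof cases
    case 1
    then show ?thesis using that[of "\<lambda>_. 0"] by simp
  next
    case (2 b)
    then show ?thesis using that[of "\<lambda>u. coeff b (mark u)"] by simp
  qed
  have "0 \<le> hankel p y y" if "(\<Sum>u\<in>hankel_words p. w u * y u) = 0" for y
  proof -
    have "2 * hankel p y y = (\<Sum>a\<leftarrow>ps. (\<Sum>u\<in>hankel_words p. coeff a (mark u) * y u)\<^sup>2)"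
      by (simp add: hankel_sds[OF sds] w that)
    also have "\<dots> \<ge> 0" by (rule sum_list_nonneg) auto
    finally show ?thesis by simp
  qed
  then show ?thesis by (rule that)
qed

section \<open>Isotropic vectors of the Hankel form\<close>

lemma hankel_sym:
  assumes "nc_symmetric p"
  shows "hankel p y z = hankel p z y"
proof -
  have "coeff p (rev u @ v) = coeff p (rev v @ u)" for u v
    using assms[unfolded nc_symmetric_iff, rule_format, of "rev u @ v"] by simp
  then show ?thesis
    unfolding hankel_def by (subst sum.swap) (simp add: mult_ac)
qed

lemma hankel_expand:
  assumes "nc_symmetric p"
  shows "hankel p (\<lambda>w. y w + t * z w) (\<lambda>w. y w + t * z w) =
    hankel p y y + 2 * t * hankel p y z + t\<^sup>2 * hankel p z z"
proof -
  have "hankel p (\<lambda>w. y w + t * z w) (\<lambda>w. y w + t * z w) =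
      hankel p y y + t * hankel p y z + t * hankel p z y + t\<^sup>2 * hankel p z z"
    by (simp add: hankel_def sum.distrib sum_distrib_left algebra_simps power2_eq_square)
  then show ?thesis using hankel_sym[OF assms, of z y] by simp
qed

lemma affine_nonneg_slope_0:
  fixes a b :: real
  assumes "\<And>t. 0 \<le> a + 2 * t * b"
  shows "b = 0"
proof (rule ccontr)
  assume "b \<noteq> 0"
  \<comment> \<open>At the chosen \<open>t\<close> the affine function takes the value
    \<open>-1\<close>.\<close>
  then show False
    using assms[of "- (a + 1) / (2 * b)"] by (simp add: field_simps)
qed

text \<open>Along the line \<open>y + t z\<close> the form is affine in \<open>t\<close> because
  \<open>z\<close> is isotropic, and a nonnegative affine function is constant. Asking for
  nonnegativity on this line only lets the lemma work inside a hyperplane.\<close>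

lemma hankel_isotropic:
  assumes "nc_symmetric p" "hankel p z z = 0" "\<And>t. 0 \<le> hankel p (\<lambda>w. y w + t * z w) (\<lambda>w. y w + t * z w)"
  shows "hankel p y z = 0"
  by (rule affine_nonneg_slope_0[of "hankel p y y"])
    (use assms(3) in \<open>simp add: hankel_expand[OF assms(1)] assms(2)\<close>)

definition unit_word :: "'g list \<Rightarrow> 'g list \<Rightarrow> real" where
  "unit_word z = (\<lambda>w. if w = z then 1 else 0)"

lemma sum_unit_word:
  fixes p :: "'g::finite nc_poly"
  shows "z \<in> hankel_words p \<Longrightarrow> (\<Sum>u\<in>hankel_words p. f u * unit_word z u) = f z"
  by (simp add: unit_word_def if_distrib cong: if_cong)

lemma hankel_unit_word:
  fixes p :: "'g::finite nc_poly"
  assumes "z \<in> hankel_words p"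
  shows "hankel p y (unit_word z) = (\<Sum>u\<in>hankel_words p. y u * coeff p (rev u @ z))"
proof -
  have "(\<Sum>v\<in>hankel_words p. y u * unit_word z v * coeff p (rev u @ v)) = y u * coeff p (rev u @ z)" for u
    using sum_unit_word[OF assms, of "\<lambda>v. y u * coeff p (rev u @ v)"] by (simp add: mult_ac)
  then show ?thesis by (simp add: hankel_def)
qed

lemma hankel_unit_word_self:
  fixes p :: "'g::finite nc_poly"
  assumes "z \<in> hankel_words p"
  shows "hankel p (unit_word z) (unit_word z) = coeff p (rev z @ z)"
  using sum_unit_word[OF assms, of "\<lambda>u. coeff p (rev u @ z)"]
  by (simp add: hankel_unit_word[OF assms] mult_ac)

lemma hankel_unit_word_self_eq_0:
  fixes p :: "'g::finite nc_poly"
  assumes "z \<in> hankel_words p" "nc_degree p < 2 * length z"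
  shows "hankel p (unit_word z) (unit_word z) = 0"
  using assms by (simp add: hankel_unit_word_self coeff_beyond_degree)

lemma sum_hankel_words_2:
  fixes p :: "'g::finite nc_poly"
  assumes "\<And>w. 2 < length w \<Longrightarrow> f w = (0::real)"
  shows "(\<Sum>u\<in>hankel_words p. f u) = (\<Sum>i\<in>UNIV. f [i]) + (\<Sum>i\<in>UNIV. \<Sum>j\<in>UNIV. f [i, j])"
proof -
  let ?A = "range (\<lambda>i::'g. [i])" and ?B = "range (\<lambda>(i::'g, j). [i, j])"
  have "(\<Sum>u\<in>hankel_words p. f u) = (\<Sum>u\<in>?A \<union> ?B. f u)"
  proof (rule sum.mono_neutral_right)
    show "finite (hankel_words p)" by simp
    show "\<forall>w\<in>hankel_words p - (?A \<union> ?B). f w = 0"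
    proof
      fix w assume w: "w \<in> hankel_words p - (?A \<union> ?B)"
      then have "w \<noteq> []" "\<And>i. w \<noteq> [i]" "\<And>i j. w \<noteq> [i, j]"
        by (auto simp: hankel_words_def image_iff)
      then have "2 < length w"
        by (metis One_nat_def Suc_1 length_0_conv length_Suc_conv less_2_cases_iff linorder_neqE_nat)
      then show "f w = 0" by (rule assms)
    qed
  qed (auto simp: hankel_words_def)
  also have "\<dots> = (\<Sum>u\<in>?A. f u) + (\<Sum>u\<in>?B. f u)"
    by (rule sum.union_disjoint) auto
  also have "(\<Sum>u\<in>?A. f u) = (\<Sum>i\<in>UNIV. f [i])"
    by (subst sum.reindex) (auto simp: inj_on_def)
  also have "(\<Sum>u\<in>?B. f u) = (\<Sum>i\<in>UNIV. \<Sum>j\<in>UNIV. f [i, j])"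
    by (subst sum.reindex) (auto simp: inj_on_def sum.cartesian_product case_prod_unfold)
  finally show ?thesis .
qed

lemma sum_hankel_words_1:
  fixes p :: "'g::finite nc_poly"
  assumes "\<And>w. 1 < length w \<Longrightarrow> f w = (0::real)"
  shows "(\<Sum>u\<in>hankel_words p. f u) = (\<Sum>i\<in>UNIV. f [i])"
  using assms by (subst sum_hankel_words_2) auto

text \<open>Prefixing \<open>z\<close> with two or more letters already exceeds the degree, so only
  single letters pair with \<open>z\<close>.\<close>

lemma hankel_unit_word_top:
  fixes p :: "'g::finite nc_poly"
  assumes "z \<in> hankel_words p" "nc_degree p \<le> Suc (length z)"
  shows "hankel p y (unit_word z) = (\<Sum>i\<in>UNIV. coeff p (i # z) * y [i])"
proof -
  have "y w * coeff p (rev w @ z) = 0" if "1 < length w" for w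
    using assms that by (simp add: coeff_beyond_degree)
  then show ?thesis
    unfolding hankel_unit_word[OF assms(1)] by (subst sum_hankel_words_1) (auto simp: mult_ac)
qed

text \<open>The linear form \<open>w\<close> of the negative square can be replaced by one that only sees the words of
  length one. The words \<open>z\<close> of length \<open>d - 1\<close> span an isotropic subspace. If \<open>w\<close> vanishes on it, then
  \<open>hankel p _ (unit_word z)\<close> vanishes on the kernel of \<open>w\<close>, hence is a multiple of \<open>w\<close>; otherwise
  vectors can be moved into the kernel of \<open>w\<close> along some \<open>unit_word z\<close>.\<close>

lemma hankel_nonneg_on_level_1_hyperplane:
  fixes p :: "'g::finite nc_poly"
  assumes sym: "nc_symmetric p"
    and w: "\<And>y. (\<Sum>u\<in>hankel_words p. w u * y u) = 0 \<Longrightarrow> 0 \<le> hankel p y y"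
  obtains a :: "real ^ 'g" where
    "\<And>y. (\<Sum>i\<in>UNIV. a $ i * y [i]) = 0 \<Longrightarrow> 0 \<le> hankel p y y"
proof -
  define W where "W y = (\<Sum>u\<in>hankel_words p. w u * y u)" for y
  have W_add: "W (\<lambda>v. y v + t * z v) = W y + t * W z" for y z t
    by (simp add: W_def sum.distrib sum_distrib_left algebra_simps)
  show ?thesis
  proof (cases "nc_degree p \<le> 2")
    case True
    have "0 \<le> hankel p y y" if y: "(\<Sum>i\<in>UNIV. w [i] * y [i]) = 0" for y
    proof -
      \<comment> \<open>In degree at most two only pairs of single letters contribute. Erasing the
        other entries of \<open>y\<close> keeps the value of the form and reduces \<open>w\<close>
        to its values on letters.\<close>
      define y' where "y' v = (if length v = 1 then y v else 0)" for v
      have "(\<Sum>u\<in>hankel_words p. w u * y' u) = 0"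
        using y by (subst sum_hankel_words_1) (auto simp: y'_def)
      then have "0 \<le> hankel p y' y'" by (rule w)
      also have "hankel p y' y' = hankel p y y"
        unfolding hankel_def
      proof (intro sum.cong refl)
        fix u v assume uv: "u \<in> hankel_words p" "v \<in> hankel_words p"
        show "y' u * y' v * coeff p (rev u @ v) = y u * y v * coeff p (rev u @ v)"
        proof (cases "length u = 1 \<and> length v = 1")
          case False
          then have "2 < length (rev u @ v)"
            using uv by (cases u; cases v) (auto simp: hankel_words_def)
          with True have "coeff p (rev u @ v) = 0" by (intro coeff_beyond_degree) simp
          then show ?thesis by simp
        qed (simp add: y'_def)
      qed
      finally show ?thesis .
    qed
    then show ?thesis using that[of "\<chi> i. w [i]"] by simp
  next
    case False
    \<comment> \<open>With d the degree, 2 (d - 1) > d holds exactly for d > 2, the case at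
      hand.\<close>
    have top: "z \<in> hankel_words p" "hankel p (unit_word z) (unit_word z) = 0"
        "hankel p y (unit_word z) = (\<Sum>i\<in>UNIV. coeff p (i # z) * y [i])"
      if "length z = nc_degree p - 1" for y z
    proof -
      show z: "z \<in> hankel_words p" using that False by (auto simp: hankel_words_def)
      show "hankel p (unit_word z) (unit_word z) = 0"
        using that False by (intro hankel_unit_word_self_eq_0 z) auto
      show "hankel p y (unit_word z) = (\<Sum>i\<in>UNIV. coeff p (i # z) * y [i])"
        using that by (intro hankel_unit_word_top z) auto
    qed
    show ?thesis
    proof (cases "\<exists>z. length z = nc_degree p - 1 \<and> w z \<noteq> 0")
      case True
      then obtain z where z: "length z = nc_degree p - 1" "w z \<noteq> 0" by blast
      \<comment> \<open>Such a \<open>y\<close> pairs to zero with the isotropic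
        \<open>unit_word z\<close>, so moving it along \<open>unit_word z\<close> into the kernel of
        \<open>W\<close> does not change the form.\<close>
      have "0 \<le> hankel p y y" if y: "(\<Sum>i\<in>UNIV. coeff p (i # z) * y [i]) = 0" for y
      proof -
        have "W (unit_word z) = w z"
          by (simp add: W_def sum_unit_word top(1)[OF z(1)])
        then have "W (\<lambda>v. y v + (- W y / w z) * unit_word z v) = 0"
          using z(2) by (simp only: W_add) simp
        then have "0 \<le> hankel p (\<lambda>v. y v + (- W y / w z) * unit_word z v)
            (\<lambda>v. y v + (- W y / w z) * unit_word z v)"
          unfolding W_def by (rule w)
        then show ?thesis
          unfolding hankel_expand[OF sym] using top(2)[OF z(1)] top(3)[OF z(1), of y] y by simp
      qed
      then show ?thesis using that[of "\<chi> i. coeff p (i # z)"] by simp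
    next
      case all0: False
      \<comment> \<open>A word of top degree without its first letter gives a \<open>z\<close> for
        which the functional \<open>L\<close> is not zero.\<close>
      obtain x where x: "length x = nc_degree p" "coeff p x \<noteq> 0"
        using degree_attained[of p] False by auto
      then obtain i0 z where iz: "x = i0 # z" using False by (cases x) auto
      with x have z: "length z = nc_degree p - 1" and nz: "coeff p (i0 # z) \<noteq> 0" by auto
      define L where "L y = (\<Sum>i\<in>UNIV. coeff p (i # z) * y [i])" for y :: "'g list \<Rightarrow> real"
      have L_add: "L (\<lambda>v. y v + t * x v) = L y + t * L x" for y x t
        by (simp add: L_def sum.distrib sum_distrib_left algebra_simps)
      have "W (unit_word z) = 0"
        using all0 z by (auto simp: W_def sum_unit_word top(1)[OF z])
      then have W_shift: "W (\<lambda>v. y v + t * unit_word z v) = W y" for y t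
        by (simp add: W_add)
      \<comment> \<open>The kernel of \<open>W\<close> is stable under shifts by
        \<open>unit_word z\<close>, so isotropy forces \<open>L\<close> to vanish on it.\<close>
      have ker: "L y = 0" if "W y = 0" for y
      proof -
        have "0 \<le> hankel p (\<lambda>v. y v + t * unit_word z v) (\<lambda>v. y v + t * unit_word z v)" for t
          using W_shift[of y t] that unfolding W_def by (intro w) simp
        then have "hankel p y (unit_word z) = 0"
          by (rule hankel_isotropic[OF sym top(2)[OF z]])
        then show ?thesis by (simp add: L_def top(3)[OF z])
      qed
      have "L (unit_word [i0]) = coeff p (i0 # z)"
        by (simp add: L_def unit_word_def if_distrib cong: if_cong)
      with nz have L0: "L (unit_word [i0]) \<noteq> 0" by simp
      then have W0: "W (unit_word [i0]) \<noteq> 0" using ker by blast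
      \<comment> \<open>Now the kernels coincide: \<open>y\<close> is corrected into the kernel of
        \<open>W\<close> along \<open>unit_word [i0]\<close>; there \<open>L\<close> vanishes, and
        as \<open>L\<close> is nonzero at \<open>unit_word [i0]\<close>, the correction was
        zero.\<close>
      have "0 \<le> hankel p y y" if "L y = 0" for y
      proof -
        have "W (\<lambda>v. y v + (- W y / W (unit_word [i0])) * unit_word [i0] v) = 0"
          using W0 by (simp only: W_add) simp
        then have "L (\<lambda>v. y v + (- W y / W (unit_word [i0])) * unit_word [i0] v) = 0"
          by (rule ker)
        then have "W y = 0"
          using L0 W0 that by (simp only: L_add) simp
        then show ?thesis unfolding W_def by (rule w)
      qed
      then show ?thesis
        using that[of "\<chi> i. coeff p (i # z)"] by (simp add: L_def)
    qed
  qed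
qed

lemma hankel_nonneg_on_unit_normal:
  fixes p :: "'g::finite nc_poly"
  assumes "nc_symmetric p" "sigma_minus_min_hessian p \<le> 1"
  obtains u :: "real ^ 'g" where "norm u = 1"
    "\<And>y. (\<Sum>i\<in>UNIV. u $ i * y [i]) = 0 \<Longrightarrow> 0 \<le> hankel p y y"
proof -
  obtain a :: "real ^ 'g" where
    a: "\<And>y. (\<Sum>i\<in>UNIV. a $ i * y [i]) = 0 \<Longrightarrow> 0 \<le> hankel p y y"
    using hankel_nonneg_of_sigma_le_1[OF assms(2)] hankel_nonneg_on_level_1_hyperplane[OF assms(1)]
    by metis
  show ?thesis
  proof (cases "a = 0")
    case True
    \<comment> \<open>Here the form is nonnegative everywhere, and any unit vector serves.\<close>
    show ?thesis
      by (rule that[of "axis undefined 1"]) (use a True in auto)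
  next
    case False
    show ?thesis
    proof (rule that[of "(1 / norm a) *\<^sub>R a"])
      show "0 \<le> hankel p y y" if "(\<Sum>i\<in>UNIV. ((1 / norm a) *\<^sub>R a) $ i * y [i]) = 0" for y
      proof (rule a)
        have "(\<Sum>i\<in>UNIV. ((1 / norm a) *\<^sub>R a) $ i * y [i]) = (1 / norm a) * (\<Sum>i\<in>UNIV. a $ i * y [i])"
          by (simp add: sum_distrib_left)
        with that False show "(\<Sum>i\<in>UNIV. a $ i * y [i]) = 0" by simp
      qed
    qed (use False in simp)
  qed
qed

section \<open>The block matrix \<open>E2\<close>\<close>

lemma proj_orth_nth: "proj_orth u $ i $ j = (if i = j then 1 else 0) - u $ i * u $ j"
  by (simp add: proj_orth_def Finite_Cartesian_Product.mat_def)

lemma transpose_proj_orth [simp]: "Finite_Cartesian_Product.transpose (proj_orth u) = proj_orth u"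
  by (simp add: Finite_Cartesian_Product.vec_eq_iff Finite_Cartesian_Product.transpose_def proj_orth_nth mult.commute)

lemma sum_delta_minus:
  fixes f g :: "'a::finite \<Rightarrow> real"
  shows "(\<Sum>i\<in>UNIV. ((if i = j then 1 else 0) - g i) * f i) = f j - (\<Sum>i\<in>UNIV. g i * f i)"
  unfolding left_diff_distrib sum_subtractf
  by (simp add: if_distrib[of "\<lambda>x. x * _"] cong: if_cong)

lemma proj_orth_mult_vec: "proj_orth u *v a = a - (u \<bullet> a) *\<^sub>R u"
proof -
  have "(\<Sum>j\<in>UNIV. proj_orth u $ i $ j * a $ j) = a $ i - (u \<bullet> a) * u $ i" for i
    using sum_delta_minus[of i "\<lambda>j. u $ i * u $ j" "($) a"]
    by (simp add: proj_orth_nth eq_commute[of i] inner_vec_def sum_distrib_right sum_distrib_left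
        mult_ac)
  then show ?thesis
    by (simp add: Finite_Cartesian_Product.vec_eq_iff matrix_vector_mult_def)
qed

lemma proj_orth_orth: "norm u = 1 \<Longrightarrow> u \<bullet> (proj_orth u *v a) = 0"
  by (simp add: proj_orth_mult_vec inner_diff_right dot_square_norm)

lemma sum_UNIV_sum: "(\<Sum>r\<in>UNIV. f r) = (\<Sum>i\<in>UNIV. f (Inl i)) + (\<Sum>i\<in>UNIV. f (Inr i))"
  for f :: "'a::finite + 'b::finite \<Rightarrow> 'c::comm_monoid_add"
  by (subst UNIV_Plus_UNIV[symmetric], subst sum.Plus) auto

lemma transpose_block_matrix:
  "Finite_Cartesian_Product.transpose (block_matrix A B C D) =
     block_matrix (Finite_Cartesian_Product.transpose A) (Finite_Cartesian_Product.transpose C)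
       (Finite_Cartesian_Product.transpose B) (Finite_Cartesian_Product.transpose D)"
  by (auto simp: Finite_Cartesian_Product.vec_eq_iff Finite_Cartesian_Product.transpose_def block_matrix_def split: sum.split)

lemma inner_block_matrix:
  "(\<chi> r. case_sum (($) a) (($) b) r) \<bullet> (block_matrix A B C D *v (\<chi> r. case_sum (($) a) (($) b) r)) =
     a \<bullet> (A *v a) + a \<bullet> (B *v b) + b \<bullet> (C *v a) + b \<bullet> (D *v b)"
  by (simp add: inner_vec_def matrix_vector_mult_def sum_UNIV_sum block_matrix_def
      distrib_left sum.distrib)

text \<open>Only the projection of \<open>a\<close> enters, which matches vectors whose letter part
  is orthogonal to \<open>u\<close>.\<close>

lemma inner_E2:
  fixes a b :: "real ^ 'g::finite"
  shows "(\<chi> r. case_sum (($) a) (($) b) r) \<bullet> (E2 u p2 q f0 *v (\<chi> r. case_sum (($) a) (($) b) r)) =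
     (proj_orth u *v a) \<bullet> (coeff_matrix p2 *v (proj_orth u *v a)) +
     2 * (b \<bullet> (coeff_matrix q *v (proj_orth u *v a))) + b \<bullet> (coeff_matrix f0 *v b)"
proof -
  have "a \<bullet> (proj_orth u *v x) = (proj_orth u *v a) \<bullet> x" for x
    by (metis dot_lmul_matrix transpose_proj_orth vector_transpose_matrix)
  moreover have "x \<bullet> (Finite_Cartesian_Product.transpose (coeff_matrix q) *v b) = b \<bullet> (coeff_matrix q *v x)" for x
    by (metis dot_lmul_matrix inner_commute transpose_matrix_vector)
  ultimately show ?thesis
    by (simp add: E2_def Let_def inner_block_matrix flip: matrix_vector_mul_assoc)
qed

lemma psd_E2_iff:
  fixes u :: "real ^ 'g::finite"
  shows "psd_matrix (E2 u p2 q f0) \<longleftrightarrow>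
    Finite_Cartesian_Product.transpose (E2 u p2 q f0) = E2 u p2 q f0 \<and>
    (\<forall>a b. 0 \<le> (proj_orth u *v a) \<bullet> (coeff_matrix p2 *v (proj_orth u *v a)) +
       2 * (b \<bullet> (coeff_matrix q *v (proj_orth u *v a))) + b \<bullet> (coeff_matrix f0 *v b))"
proof -
  have v: "v = (\<chi> r. case_sum (($) (\<chi> i. v $ Inl i)) (($) (\<chi> i. v $ Inr i)) r)" for v :: "real ^ ('g + 'g)"
    by (auto simp: Finite_Cartesian_Product.vec_eq_iff split: sum.split)
  have "(\<forall>v. 0 \<le> v \<bullet> (E2 u p2 q f0 *v v)) \<longleftrightarrow>
     (\<forall>a b. 0 \<le> (\<chi> r. case_sum (($) a) (($) b) r) \<bullet> (E2 u p2 q f0 *v (\<chi> r. case_sum (($) a) (($) b) r)))"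
    by (metis v)
  then show ?thesis unfolding psd_matrix_def inner_E2 by blast
qed

lemma transpose_E2:
  assumes "Finite_Cartesian_Product.transpose (coeff_matrix p2) = coeff_matrix p2"
    "Finite_Cartesian_Product.transpose (coeff_matrix f0) = coeff_matrix f0"
  shows "Finite_Cartesian_Product.transpose (E2 u p2 q f0) = E2 u p2 q f0"
  by (simp add: E2_def Let_def transpose_block_matrix matrix_transpose_mul assms matrix_mul_assoc)

section \<open>From a single negative square to the canonical form\<close>

definition quad_poly :: "real ^ 'g ^ 'g \<Rightarrow> 'g::finite nc_poly" where
  "quad_poly M = (\<Sum>i\<in>UNIV. \<Sum>j\<in>UNIV. nc_const (M $ i $ j) * (nc_var i * nc_var j))"

lemma coeff_quad_poly: "coeff (quad_poly M) w = (case w of [i, j] \<Rightarrow> M $ i $ j | _ \<Rightarrow> 0)"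
proof -
  have *: "(\<Sum>i\<in>UNIV. \<Sum>j\<in>UNIV. if a = i \<and> b = j then M $ i $ j else 0) = M $ a $ b" for a b
  proof -
    have "(\<Sum>j\<in>UNIV. if a = i \<and> b = j then M $ i $ j else 0) = (if a = i then M $ i $ b else 0)" for i
      by simp
    then show ?thesis by simp
  qed
  have "coeff (quad_poly M) w =
      (\<Sum>i\<in>UNIV. \<Sum>j\<in>UNIV. if w = [i, j] then M $ i $ j else 0)"
    unfolding quad_poly_def lookup_sum
    by (intro sum.cong refl) (auto simp: coeff_var_mult coeff_var split: list.split)
  with * show ?thesis by (auto split: list.split)
qed

lemma homogeneous_quad_poly [simp]: "nc_homogeneous 2 (quad_poly M)"
  by (auto simp: nc_homogeneous_iff coeff_quad_poly split: list.splits)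

lemma coeff_matrix_quad_poly [simp]: "coeff_matrix (quad_poly M) = M"
  by (simp add: coeff_matrix_def coeff_quad_poly Finite_Cartesian_Product.vec_eq_iff)

lemma quad_poly_coeff_matrix:
  assumes "nc_homogeneous 2 a"
  shows "quad_poly (coeff_matrix a) = a"
proof (rule poly_mapping_eqI)
  fix w
  show "coeff (quad_poly (coeff_matrix a)) w = coeff a w"
  proof (cases "length w = 2")
    case True
    then obtain i j where "w = [i, j]" by (auto simp: length_Suc_conv numeral_2_eq_2)
    then show ?thesis by (simp add: coeff_quad_poly coeff_matrix_def)
  next
    case False
    then show ?thesis
      using assms by (auto simp: coeff_quad_poly nc_homogeneous_iff split: list.split)
  qed
qed

lemma unit_word_singleton: "2 \<le> length z \<Longrightarrow> unit_word z [i] = 0"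
  by (auto simp: unit_word_def)

text \<open>The letter part \<open>v\<close> probes the first block of \<open>E2\<close>, the
  two-letter part \<open>Y\<close> the second.\<close>

definition test_vec :: "real ^ 'g \<Rightarrow> real ^ 'g ^ 'g \<Rightarrow> 'g list \<Rightarrow> real" where
  "test_vec v Y w = (case w of [i] \<Rightarrow> v $ i | [i, j] \<Rightarrow> Y $ i $ j | _ \<Rightarrow> 0)"

lemma test_vec_simps [simp]: "test_vec v Y [i] = v $ i" "test_vec v Y [i, j] = Y $ i $ j"
  "2 < length w \<Longrightarrow> test_vec v Y w = 0"
  by (auto simp: test_vec_def split: list.split)

lemma sum_test_vec:
  fixes p :: "'g::finite nc_poly"
  shows "(\<Sum>w\<in>hankel_words p. test_vec v Y w * f w) =
    (\<Sum>i\<in>UNIV. v $ i * f [i]) + (\<Sum>i\<in>UNIV. \<Sum>j\<in>UNIV. Y $ i $ j * f [i, j])"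
  using sum_hankel_words_2[of "\<lambda>w. test_vec v Y w * f w" p] by simp

text \<open>The left word enters reversed, hence the order \<open>[j, i]\<close> wherever
  \<open>Y\<close> stands on the left.\<close>

lemma hankel_test_vec:
  fixes p :: "'g::finite nc_poly"
  shows "hankel p (test_vec v Y) (test_vec v' Y') =
    (\<Sum>i\<in>UNIV. \<Sum>j\<in>UNIV. v $ i * v' $ j * coeff p [i, j]) +
    (\<Sum>i\<in>UNIV. \<Sum>j\<in>UNIV. \<Sum>k\<in>UNIV. v $ i * Y' $ j $ k * coeff p [i, j, k]) +
    (\<Sum>i\<in>UNIV. \<Sum>j\<in>UNIV. \<Sum>k\<in>UNIV. Y $ i $ j * v' $ k * coeff p [j, i, k]) +
    (\<Sum>i\<in>UNIV. \<Sum>j\<in>UNIV. \<Sum>k\<in>UNIV. \<Sum>l\<in>UNIV. Y $ i $ j * Y' $ k $ l * coeff p [j, i, k, l])"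
proof -
  have "hankel p (test_vec v Y) (test_vec v' Y') =
      (\<Sum>w\<in>hankel_words p. test_vec v Y w * (\<Sum>w'\<in>hankel_words p. test_vec v' Y' w' * coeff p (rev w @ w')))"
    by (simp add: hankel_def sum_distrib_left mult.assoc)
  then show ?thesis
    unfolding sum_test_vec by (simp add: sum.distrib sum_distrib_left distrib_left mult.assoc)
qed

section \<open>Structure of \<open>p\<close> when its Hankel form is nonnegative on the normal
  hyperplane of \<open>u\<close>\<close>

locale hankel_nonneg_hyperplane =
  fixes p :: "'g::finite nc_poly" and u :: "real ^ 'g"
  assumes sym: "nc_symmetric p" and norm_u: "norm u = 1"
    and hankel_nonneg: "(\<Sum>i\<in>UNIV. u $ i * y [i]) = 0 \<Longrightarrow> 0 \<le> hankel p y y"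
begin

lemma coeff_rev: "coeff p (rev w) = coeff p w"
  using sym by (simp add: nc_symmetric_iff)

lemma sum_u_u: "(\<Sum>i\<in>UNIV. u $ i * u $ i) = 1"
  using norm_u by (simp add: norm_eq_1 inner_vec_def)

lemma isotropic:
  assumes "(\<Sum>i\<in>UNIV. u $ i * y [i]) = 0" "(\<Sum>i\<in>UNIV. u $ i * z [i]) = 0" "hankel p z z = 0"
  shows "hankel p y z = 0"
proof (rule hankel_isotropic[OF sym assms(3)], rule hankel_nonneg)
  fix t
  have "(\<Sum>i\<in>UNIV. u $ i * (y [i] + t * z [i])) =
      (\<Sum>i\<in>UNIV. u $ i * y [i]) + t * (\<Sum>i\<in>UNIV. u $ i * z [i])"
    by (simp add: sum.distrib sum_distrib_left algebra_simps)
  with assms show "(\<Sum>i\<in>UNIV. u $ i * (y [i] + t * z [i])) = 0" by simp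
qed

text \<open>A unit vector at a word of length at least two vanishes on letters, so it lies in the
  hyperplane.\<close>

lemma isotropic_word:
  assumes "z \<in> hankel_words p" "2 \<le> length z" "nc_degree p < 2 * length z"
    "(\<Sum>i\<in>UNIV. u $ i * y [i]) = 0"
  shows "hankel p y (unit_word z) = 0"
proof (rule isotropic[OF assms(4)])
  show "hankel p (unit_word z) (unit_word z) = 0"
    using assms by (intro hankel_unit_word_self_eq_0) auto
qed (simp add: unit_word_singleton[OF assms(2)])

text \<open>Cut a word of top degree d after two letters: both unit vectors lie in the hyperplane,
  and the longer one is isotropic when 2 (d - 2) > d, that is, when d > 4.\<close>

lemma degree_le_4: "nc_degree p \<le> 4"
proof (rule ccontr)
  assume d: "\<not> nc_degree p \<le> 4"
  then obtain w where w: "length w = nc_degree p" "coeff p w \<noteq> 0"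
    using degree_attained[of p] by auto
  have U: "drop 2 w \<in> hankel_words p" "rev (take 2 w) \<in> hankel_words p"
    using w d by (auto simp: hankel_words_def)
  have "hankel p (unit_word (rev (take 2 w))) (unit_word (drop 2 w)) = 0"
    using w d U by (intro isotropic_word) (auto simp: unit_word_singleton)
  moreover have "hankel p (unit_word (rev (take 2 w))) (unit_word (drop 2 w)) = coeff p w"
    using sum_unit_word[OF U(2), of "\<lambda>v. coeff p (rev v @ drop 2 w)"]
    by (simp add: hankel_unit_word[OF U(1)] mult.commute)
  ultimately show False using w by simp
qed

text \<open>Words of length three are isotropic as 2 * 3 > 4. The vector \<open>y\<close> is column
  \<open>j\<close> of the projection orthogonal to \<open>u\<close>, so pairing it with the word
  shows that the first letter only enters through \<open>u\<close>.\<close>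

lemma coeff_4_left: "coeff p [j, a, b, c] = u $ j * (\<Sum>i\<in>UNIV. u $ i * coeff p [i, a, b, c])"
proof -
  define y where "y = test_vec (\<chi> i. (if i = j then 1 else 0) - u $ i * u $ j) 0"
  have y: "(\<Sum>i\<in>UNIV. f i * y [i]) = f j - u $ j * (\<Sum>i\<in>UNIV. u $ i * f i)" for f :: "'g \<Rightarrow> real"
    using sum_delta_minus[of j "\<lambda>i. u $ i * u $ j" f]
    by (simp add: y_def sum_distrib_left mult_ac)
  show ?thesis
  \<comment> \<open>This fails only in degree 0, where the coefficients vanish anyway.\<close>
  proof (cases "3 \<le> nc_degree p + 2")
    case True
    then have U: "[a, b, c] \<in> hankel_words p" by (simp add: hankel_words_def)
    have "hankel p y (unit_word [a, b, c]) = 0"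
      using degree_le_4 U by (intro isotropic_word) (simp_all add: y sum_u_u)
    then show ?thesis
      using degree_le_4 by (simp add: hankel_unit_word_top[OF U] y)
  qed (simp add: coeff_beyond_degree)
qed

definition f_matrix :: "real ^ 'g ^ 'g" where
  "f_matrix = (\<chi> i k. \<Sum>a\<in>UNIV. \<Sum>b\<in>UNIV. u $ a * u $ b * coeff p [a, i, k, b])"

text \<open>The left factorization is applied to the word and to its reversal.\<close>

lemma coeff_4: "coeff p [j, i, k, l] = u $ j * f_matrix $ i $ k * u $ l"
proof -
  have "coeff p [a, i, k, l] = u $ l * (\<Sum>b\<in>UNIV. u $ b * coeff p [a, i, k, b])" for a
    using coeff_4_left[of l k i a] coeff_rev[of "[a, i, k, l]"] coeff_rev[of "[a, i, k, _]"] by simp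
  then have "u $ j * (\<Sum>a\<in>UNIV. u $ a * coeff p [a, i, k, l]) = u $ j * f_matrix $ i $ k * u $ l"
    by (simp add: f_matrix_def sum_distrib_left sum_distrib_right mult_ac)
  then show ?thesis using coeff_4_left[of j i k l] by simp
qed

text \<open>The vector \<open>Y\<close> puts \<open>w\<close> on the words beginning with
  \<open>j\<close>. By \<open>coeff_4\<close> its form value contains the factor
  \<open>u \<bullet> w\<close>, so it is isotropic and pairs to zero with every \<open>v\<close>
  orthogonal to \<open>u\<close>.\<close>

lemma coeff_3_orth:
  assumes v: "u \<bullet> v = 0" and w: "u \<bullet> w = 0"
  shows "(\<Sum>i\<in>UNIV. \<Sum>k\<in>UNIV. v $ i * w $ k * coeff p [i, j, k]) = 0"
proof -
  define Y :: "real ^ 'g ^ 'g" where "Y = (\<chi> a. if a = j then w else 0)"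
  have Y: "(\<Sum>k\<in>UNIV. \<Sum>l\<in>UNIV. Y $ k $ l * f k l) = (\<Sum>l\<in>UNIV. w $ l * f j l)" for f
  proof -
    have "(\<Sum>k\<in>UNIV. \<Sum>l\<in>UNIV. Y $ k $ l * f k l) =
        (\<Sum>k\<in>UNIV. if k = j then \<Sum>l\<in>UNIV. w $ l * f j l else 0)"
      by (rule sum.cong) (auto simp: Y_def)
    then show ?thesis by simp
  qed
  have sum_w: "(\<Sum>b\<in>UNIV. w $ b * u $ b) = 0"
    using w by (simp add: inner_vec_def mult.commute)
  have "(\<Sum>l\<in>UNIV. w $ l * coeff p [b, j, j, l]) = u $ b * f_matrix $ j $ j * (\<Sum>l\<in>UNIV. w $ l * u $ l)" for b
    by (simp add: coeff_4 sum_distrib_left mult_ac)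
  then have inner: "(\<Sum>l\<in>UNIV. w $ l * coeff p [b, j, j, l]) = 0" for b
    by (simp add: sum_w)
  have "hankel p (test_vec 0 Y) (test_vec 0 Y) =
      (\<Sum>a\<in>UNIV. \<Sum>b\<in>UNIV. Y $ a $ b * (\<Sum>k\<in>UNIV. \<Sum>l\<in>UNIV. Y $ k $ l * coeff p [b, a, k, l]))"
    by (simp add: hankel_test_vec sum_distrib_left mult_ac)
  also have "\<dots> = (\<Sum>b\<in>UNIV. w $ b * (\<Sum>l\<in>UNIV. w $ l * coeff p [b, j, j, l]))"
    by (simp only: Y)
  also have "\<dots> = 0"
    by (simp add: inner)
  finally have "hankel p (test_vec 0 Y) (test_vec 0 Y) = 0" .
  then have "hankel p (test_vec v 0) (test_vec 0 Y) = 0"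
    using v by - (rule isotropic, simp_all add: inner_vec_def)
  moreover have "hankel p (test_vec v 0) (test_vec 0 Y) =
      (\<Sum>i\<in>UNIV. v $ i * (\<Sum>a\<in>UNIV. \<Sum>k\<in>UNIV. Y $ a $ k * coeff p [i, a, k]))"
    by (simp add: hankel_test_vec sum_distrib_left mult_ac)
  ultimately show ?thesis
    by (simp add: Y sum_distrib_left mult_ac)
qed

text \<open>The part of the shape \<phi> l \<phi> with l linear occurs both in \<phi> q and in
  \<open>q\<^sup>T \<phi>\<close>; subtracting half of it makes the sum count it once.\<close>

definition q_matrix :: "real ^ 'g ^ 'g" where
  "q_matrix = (\<chi> j k. (\<Sum>i\<in>UNIV. u $ i * coeff p [i, j, k]) -
     u $ k * (\<Sum>i\<in>UNIV. \<Sum>l\<in>UNIV. u $ i * u $ l * coeff p [i, j, l]) / 2)"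

text \<open>Projecting both outer letters off \<open>u\<close> gives zero by
  \<open>coeff_3_orth\<close>; expanding the two factors of the form I - \<open>u u\<^sup>T\<close>
  expresses the coefficient by its contractions with \<open>u\<close>.\<close>

lemma coeff_3: "coeff p [i, j, k] = u $ i * q_matrix $ j $ k + q_matrix $ j $ i * u $ k"
proof -
  define P where "P i = (\<chi> a. (if a = i then 1 else 0) - u $ a * u $ i)" for i
  have P: "(\<Sum>a\<in>UNIV. P i $ a * f a) = f i - u $ i * (\<Sum>a\<in>UNIV. u $ a * f a)" for i f
    using sum_delta_minus[of i "\<lambda>a. u $ a * u $ i" f]
    by (simp add: P_def sum_distrib_left mult_ac)
  have "u \<bullet> P i = 0" for i
    using P[of i "($) u"] by (simp add: inner_vec_def sum_u_u mult.commute)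
  then have "(\<Sum>a\<in>UNIV. \<Sum>b\<in>UNIV. P i $ a * P k $ b * coeff p [a, j, b]) = 0"
    by (intro coeff_3_orth) auto
  then have P0: "(\<Sum>a\<in>UNIV. P i $ a * (\<Sum>b\<in>UNIV. P k $ b * coeff p [a, j, b])) = 0"
    by (simp add: sum_distrib_left mult_ac)
  have R: "(\<Sum>a\<in>UNIV. u $ a * (coeff p [a, j, k] - u $ k * R a)) =
      (\<Sum>a\<in>UNIV. u $ a * coeff p [a, j, k]) - u $ k * (\<Sum>a\<in>UNIV. u $ a * R a)" for R
    by (simp add: right_diff_distrib sum_subtractf sum_distrib_left mult_ac)
  from P0 have "coeff p [i, j, k] - u $ k * (\<Sum>b\<in>UNIV. u $ b * coeff p [i, j, b]) -
     u $ i * ((\<Sum>a\<in>UNIV. u $ a * coeff p [a, j, k]) -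
       u $ k * (\<Sum>a\<in>UNIV. u $ a * (\<Sum>b\<in>UNIV. u $ b * coeff p [a, j, b]))) = 0"
    unfolding P R .
  then have "coeff p [i, j, k] = u $ k * (\<Sum>b\<in>UNIV. u $ b * coeff p [i, j, b]) +
     u $ i * (\<Sum>a\<in>UNIV. u $ a * coeff p [a, j, k]) -
     u $ i * u $ k * (\<Sum>a\<in>UNIV. u $ a * (\<Sum>b\<in>UNIV. u $ b * coeff p [a, j, b]))"
    by (simp add: right_diff_distrib mult.assoc)
  then have "coeff p [i, j, k] = u $ k * (\<Sum>b\<in>UNIV. u $ b * coeff p [i, j, b]) +
     u $ i * (\<Sum>a\<in>UNIV. u $ a * coeff p [a, j, k]) -
     u $ i * u $ k * (\<Sum>a\<in>UNIV. \<Sum>b\<in>UNIV. u $ a * u $ b * coeff p [a, j, b])"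
    by (simp add: sum_distrib_left mult.assoc)
  moreover have "coeff p [i, j, b] = coeff p [b, j, i]" for b
    using coeff_rev[of "[i, j, b]"] by simp
  ultimately show ?thesis
    by (simp add: q_matrix_def algebra_simps)
qed

lemma transpose_f_matrix: "Finite_Cartesian_Product.transpose f_matrix = f_matrix"
proof -
  have "coeff p [a, k, i, b] = coeff p [b, i, k, a]" for a k i b
    using coeff_rev[of "[a, k, i, b]"] by simp
  then show ?thesis
    by (simp add: Finite_Cartesian_Product.vec_eq_iff Finite_Cartesian_Product.transpose_def f_matrix_def)
      (subst sum.swap, simp add: mult_ac)
qed

lemma transpose_coeff_matrix:
  "Finite_Cartesian_Product.transpose (coeff_matrix (nc_hom_part 2 p)) = coeff_matrix (nc_hom_part 2 p)"
proof -
  have "coeff p [i, j] = coeff p [j, i]" for i j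
    using coeff_rev[of "[i, j]"] by simp
  then show ?thesis
    by (simp add: Finite_Cartesian_Product.vec_eq_iff Finite_Cartesian_Product.transpose_def coeff_matrix_def coeff_hom_part)
qed

lemma psd_E2: "psd_matrix (E2 u (nc_hom_part 2 p) (quad_poly q_matrix) (quad_poly f_matrix))"
  unfolding psd_E2_iff
proof (intro conjI allI)
  show "Finite_Cartesian_Product.transpose (E2 u (nc_hom_part 2 p) (quad_poly q_matrix) (quad_poly f_matrix)) =
      E2 u (nc_hom_part 2 p) (quad_poly q_matrix) (quad_poly f_matrix)"
    by (rule transpose_E2) (simp_all add: transpose_f_matrix transpose_coeff_matrix)
  fix a' b
  define a where "a = proj_orth u *v a'"
  \<comment> \<open>Under \<open>mark\<close> this vector stands for the border entries
    \<open>h\<^sub>i \<phi>(x)\<close> weighted by \<open>b\<close>.\<close>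
  define Y :: "real ^ 'g ^ 'g" where "Y = (\<chi> i j. b $ i * u $ j)"
  have a: "(\<Sum>i\<in>UNIV. u $ i * a $ i) = 0"
    using proj_orth_orth[OF norm_u, of a'] by (simp add: inner_vec_def a_def)
  have "0 \<le> hankel p (test_vec a Y) (test_vec a Y)"
    by (rule hankel_nonneg) (simp add: a)
  also have "\<dots> = (\<Sum>i\<in>UNIV. \<Sum>j\<in>UNIV. a $ i * a $ j * coeff p [i, j]) +
      2 * (\<Sum>j\<in>UNIV. b $ j * (\<Sum>k\<in>UNIV. a $ k * (\<Sum>i\<in>UNIV. u $ i * coeff p [i, j, k]))) +
      (\<Sum>i\<in>UNIV. \<Sum>j\<in>UNIV. \<Sum>k\<in>UNIV. \<Sum>l\<in>UNIV. Y $ i $ j * Y $ k $ l * coeff p [j, i, k, l])"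
  proof -
    have "(\<Sum>i\<in>UNIV. \<Sum>j\<in>UNIV. \<Sum>k\<in>UNIV. Y $ i $ j * a $ k * coeff p [j, i, k]) =
        (\<Sum>j\<in>UNIV. b $ j * (\<Sum>k\<in>UNIV. a $ k * (\<Sum>i\<in>UNIV. u $ i * coeff p [i, j, k])))"
    proof -
      have "(\<Sum>i\<in>UNIV. \<Sum>j\<in>UNIV. \<Sum>k\<in>UNIV. Y $ i $ j * a $ k * coeff p [j, i, k]) =
          (\<Sum>i\<in>UNIV. \<Sum>k\<in>UNIV. \<Sum>j\<in>UNIV. Y $ i $ j * a $ k * coeff p [j, i, k])"
        by (rule sum.cong[OF refl]) (rule sum.swap)
      then show ?thesis by (simp add: Y_def sum_distrib_left mult_ac)
    qed
    \<comment> \<open>The two mixed terms agree because \<open>p\<close> is symmetric.\<close>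
    moreover have "(\<Sum>i\<in>UNIV. \<Sum>j\<in>UNIV. \<Sum>k\<in>UNIV. a $ i * Y $ j $ k * coeff p [i, j, k]) =
        (\<Sum>i\<in>UNIV. \<Sum>j\<in>UNIV. \<Sum>k\<in>UNIV. Y $ i $ j * a $ k * coeff p [j, i, k])"
    proof -
      have c: "coeff p [i, j, k] = coeff p [k, j, i]" for i j k
        using coeff_rev[of "[i, j, k]"] by simp
      have "(\<Sum>i\<in>UNIV. \<Sum>j\<in>UNIV. \<Sum>k\<in>UNIV. a $ i * Y $ j $ k * coeff p [i, j, k]) =
          (\<Sum>j\<in>UNIV. \<Sum>i\<in>UNIV. \<Sum>k\<in>UNIV. a $ i * Y $ j $ k * coeff p [k, j, i])"
        by (subst sum.swap) (simp add: c)
      also have "\<dots> = (\<Sum>j\<in>UNIV. \<Sum>k\<in>UNIV. \<Sum>i\<in>UNIV. a $ i * Y $ j $ k * coeff p [k, j, i])"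
        by (rule sum.cong[OF refl]) (rule sum.swap)
      finally show ?thesis by (simp add: mult_ac)
    qed
    ultimately show ?thesis by (simp add: hankel_test_vec)
  qed
  also have "(\<Sum>i\<in>UNIV. \<Sum>j\<in>UNIV. a $ i * a $ j * coeff p [i, j]) =
      a \<bullet> (coeff_matrix (nc_hom_part 2 p) *v a)"
    by (simp add: inner_vec_def matrix_vector_mult_def coeff_matrix_def coeff_hom_part
        sum_distrib_left mult_ac)
  also have "(\<Sum>j\<in>UNIV. b $ j * (\<Sum>k\<in>UNIV. a $ k * (\<Sum>i\<in>UNIV. u $ i * coeff p [i, j, k]))) =
      b \<bullet> (q_matrix *v a)"
  proof -
    \<comment> \<open>The halved correction in \<open>q_matrix\<close> is a multiple of
      \<open>u\<close> and disappears against \<open>a\<close>.\<close>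
    have lin: "(\<Sum>k\<in>UNIV. (f k - u $ k * S / 2) * a $ k) =
        (\<Sum>k\<in>UNIV. a $ k * f k) - (\<Sum>k\<in>UNIV. u $ k * a $ k) * (S / 2)" for f S
      unfolding sum_distrib_right sum_subtractf[symmetric]
      by (rule sum.cong) (simp_all add: algebra_simps)
    have "(q_matrix *v a) $ j = (\<Sum>k\<in>UNIV. a $ k * (\<Sum>i\<in>UNIV. u $ i * coeff p [i, j, k]))" for j
      using lin[of "\<lambda>k. \<Sum>i\<in>UNIV. u $ i * coeff p [i, j, k]"]
      by (simp add: matrix_vector_mult_def q_matrix_def a)
    then show ?thesis by (simp add: inner_vec_def)
  qed
  also have "(\<Sum>i\<in>UNIV. \<Sum>j\<in>UNIV. \<Sum>k\<in>UNIV. \<Sum>l\<in>UNIV. Y $ i $ j * Y $ k $ l * coeff p [j, i, k, l]) =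
      b \<bullet> (f_matrix *v b)"
  proof -
    have "(\<Sum>i\<in>UNIV. \<Sum>j\<in>UNIV. \<Sum>k\<in>UNIV. \<Sum>l\<in>UNIV. Y $ i $ j * Y $ k $ l * coeff p [j, i, k, l]) =
        (\<Sum>i\<in>UNIV. \<Sum>k\<in>UNIV. \<Sum>j\<in>UNIV. \<Sum>l\<in>UNIV. Y $ i $ j * Y $ k $ l * coeff p [j, i, k, l])"
      by (rule sum.cong[OF refl]) (rule sum.swap)
    also have "\<dots> = b \<bullet> (f_matrix *v b)"
      by (simp add: inner_vec_def matrix_vector_mult_def f_matrix_def Y_def sum_distrib_left
          sum_distrib_right mult_ac)
    finally show ?thesis .
  qed
  finally show "0 \<le> (proj_orth u *v a') \<bullet> (coeff_matrix (nc_hom_part 2 p) *v (proj_orth u *v a')) +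
      2 * (b \<bullet> (coeff_matrix (quad_poly q_matrix) *v (proj_orth u *v a'))) +
      b \<bullet> (coeff_matrix (quad_poly f_matrix) *v b)"
    by (simp add: a_def)
qed

lemma canonical_form_exists:
  "canonical_form p u (nc_hom_part 0 p) (nc_hom_part 1 p) (nc_hom_part 2 p)
     (quad_poly q_matrix) (quad_poly f_matrix)"
proof -
  let ?q = "quad_poly q_matrix" and ?f = "quad_poly f_matrix" and ?u = "linear_form u"
  have "coeff p w = coeff (nc_hom_part 0 p + nc_hom_part 1 p + nc_hom_part 2 p + ?u * ?q
      + nc_adjoint ?q * ?u + ?u * ?f * ?u) w" for w
  proof -
    consider "w = []" | i where "w = [i]" | i j where "w = [i, j]" | i j k where "w = [i, j, k]"
      | i j k l where "w = [i, j, k, l]" | i j k l m v where "w = i # j # k # l # m # v"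
      by (metis list.exhaust)
    then show ?thesis
    proof cases
      case (6 i j k l m v)
      have "coeff p w = 0"
        using degree_le_4 6 by (intro coeff_beyond_degree) simp
      then show ?thesis
        using 6 by (simp add: lookup_add coeff_hom_part coeff_linear_form_mult
            coeff_mult_linear_form coeff_quad_poly split: list.split)
    qed (simp_all add: lookup_add coeff_hom_part coeff_linear_form_mult coeff_mult_linear_form
        coeff_quad_poly coeff_3 coeff_4)
  qed
  moreover have "nc_symmetric (nc_hom_part k p)" "nc_homogeneous k (nc_hom_part k p)" for k
    by (auto simp: nc_symmetric_iff nc_homogeneous_iff coeff_hom_part coeff_rev)
  ultimately show ?thesis
    using psd_E2 norm_u by (simp add: canonical_form_def Let_def poly_mapping_eqI)
qed

end

lemma canonical_form_of_sigma_le_1: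
  fixes p :: "'g::finite nc_poly"
  assumes "nc_symmetric p" "sigma_minus_min_hessian p \<le> 1"
  shows "\<exists>u p0 p1 p2 q f0. canonical_form p u p0 p1 p2 q f0"
proof -
  obtain u :: "real ^ 'g" where "norm u = 1"
    "\<And>y. (\<Sum>i\<in>UNIV. u $ i * y [i]) = 0 \<Longrightarrow> 0 \<le> hankel p y y"
    by (rule hankel_nonneg_on_unit_normal[OF assms]) blast
  then interpret hankel_nonneg_hyperplane p u
    using assms by unfold_locales
  show ?thesis using canonical_form_exists by blast
qed

section \<open>From the canonical form to a single negative square\<close>

lemma psd_kernel_pair:
  fixes a b c :: real
  assumes "\<And>t. 0 \<le> a + 2 * t * b + t\<^sup>2 * c" "c = 0"
  shows "b = 0"
  by (rule affine_nonneg_slope_0[of a]) (use assms in auto)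

text \<open>A step of the Cholesky decomposition: eliminate the pivot \<open>s\<close> of the support.\<close>

lemma psd_decomposition_on:
  fixes A :: "'n::finite \<Rightarrow> 'n \<Rightarrow> real"
  assumes "finite S" "\<And>i j. A i j = A j i" "\<And>i j. i \<notin> S \<Longrightarrow> A i j = 0"
    and "\<And>x. 0 \<le> (\<Sum>i\<in>UNIV. \<Sum>j\<in>UNIV. A i j * x i * x j)"
  shows "\<exists>vs. \<forall>i j. A i j = (\<Sum>v\<leftarrow>vs. v i * v j)"
  using assms
proof (induction S arbitrary: A rule: finite_induct)
  case empty
  then show ?case by (intro exI[of _ "[]"]) simp
next
  case (insert s S)
  let ?Q = "\<lambda>x. \<Sum>i\<in>UNIV. \<Sum>j\<in>UNIV. A i j * x i * x j"
  have shift: "?Q (\<lambda>i. x i + t * (if i = s then 1 else 0)) =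
      ?Q x + 2 * t * (\<Sum>i\<in>UNIV. A s i * x i) + t\<^sup>2 * A s s" for x t
  proof -
    let ?B = "\<lambda>x y. \<Sum>i\<in>UNIV. x i * (\<Sum>j\<in>UNIV. A i j * y j)"
    let ?e = "\<lambda>i. if i = s then 1 else (0 :: real)"
    have QB: "?Q z = ?B z z" for z
      by (simp add: sum_distrib_left mult_ac)
    have "?B (\<lambda>i. x i + t * ?e i) (\<lambda>i. x i + t * ?e i) =
        ?B x x + t * ?B x ?e + t * ?B ?e x + t\<^sup>2 * ?B ?e ?e"
      by (simp only: distrib_left distrib_right sum.distrib sum_distrib_left power2_eq_square mult_ac
          add_ac)
    moreover have "?B x ?e = (\<Sum>i\<in>UNIV. A s i * x i)"
      by (simp add: insert.prems(1)[of _ s] if_distrib[of "\<lambda>x. _ * x"] mult.commute cong: if_cong)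
    moreover have "?B ?e y = (\<Sum>i\<in>UNIV. A s i * y i)" for y
      by (simp add: if_distrib[of "\<lambda>x. x * _"] cong: if_cong)
    moreover have "(\<Sum>i\<in>UNIV. A s i * ?e i) = A s s"
      by (simp add: if_distrib[of "\<lambda>x. _ * x"] cong: if_cong)
    ultimately show ?thesis unfolding QB by simp
  qed
  show ?case
  proof (cases "A s s = 0")
    case True
    \<comment> \<open>A zero pivot is an isotropic direction, so its whole row vanishes.\<close>
    have row: "A s j = 0" for j
    proof (rule psd_kernel_pair[of "A j j" _ 0])
      fix t
      let ?e = "\<lambda>i. if i = j then 1 else (0 :: real)"
      have "?Q ?e = (\<Sum>i\<in>UNIV. ?e i * (\<Sum>k\<in>UNIV. A i k * ?e k))"
        by (simp only: sum_distrib_left mult_ac)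
      also have "\<dots> = A j j"
        by (simp add: if_distrib[of "\<lambda>x. x * _"] if_distrib[of "\<lambda>x. _ * x"] cong: if_cong)
      finally have "?Q ?e = A j j" .
      moreover have "(\<Sum>i\<in>UNIV. A s i * ?e i) = A s j"
        by (simp add: if_distrib[of "\<lambda>x. _ * x"] cong: if_cong)
      ultimately show "0 \<le> A j j + 2 * t * A s j + t\<^sup>2 * 0"
        using insert.prems(3)[of "\<lambda>i. (if i = j then 1 else 0) + t * (if i = s then 1 else 0)"]
        by (simp only: shift True)
    qed simp
    show ?thesis
    proof (rule insert.IH)
      show "A i j = 0" if "i \<notin> S" for i j
        using row that insert.prems(2) by (cases "i = s") auto
    qed (use insert.prems in auto)
  next
    case False
    have "?Q (\<lambda>i. 0 + 1 * (if i = s then 1 else 0)) = A s s" by (simp only: shift) simp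
    with insert.prems(3)[of "\<lambda>i. 0 + 1 * (if i = s then 1 else 0)"] False have pos: "A s s > 0"
      by simp
    \<comment> \<open>Subtracting this rank one piece leaves the Schur complement of the
      pivot.\<close>
    define v where "v i = A s i / sqrt (A s s)" for i
    have vv: "v i * v j = A s i * A s j / A s s" for i j
      using pos by (simp add: v_def)
    have "\<exists>vs. \<forall>i j. A i j - v i * v j = (\<Sum>v\<leftarrow>vs. v i * v j)"
    proof (rule insert.IH)
      show "A i j - v i * v j = A j i - v j * v i" for i j
        by (simp add: insert.prems(1)[of i j])
      show "A i j - v i * v j = 0" if "i \<notin> S" for i j
      proof (cases "i = s")
        case True
        then show ?thesis using pos by (simp add: vv)
      next
        case False
        then have "A i k = 0" for k using insert.prems(2) that by auto
        then show ?thesis using insert.prems(1)[of s i] by (simp add: vv)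
      qed
      show "0 \<le> (\<Sum>i\<in>UNIV. \<Sum>j\<in>UNIV. (A i j - v i * v j) * x i * x j)" for x
      proof -
        let ?l = "\<Sum>i\<in>UNIV. A s i * x i"
        have "(\<Sum>i\<in>UNIV. \<Sum>j\<in>UNIV. (A i j - v i * v j) * x i * x j) =
            ?Q x - (\<Sum>i\<in>UNIV. \<Sum>j\<in>UNIV. (A s i * x i) * (A s j * x j)) / A s s"
          unfolding sum_divide_distrib sum_subtractf[symmetric]
          by (intro sum.cong refl) (simp add: vv algebra_simps)
        also have "\<dots> = ?Q x - ?l\<^sup>2 / A s s"
          by (simp add: power2_eq_square sum_product)
        \<comment> \<open>The complement is nonnegative because its value at \<open>x\<close> is
          that of \<open>A\<close> after minimizing over the pivot coordinate.\<close>
        also have "\<dots> = ?Q (\<lambda>i. x i + (- ?l / A s s) * (if i = s then 1 else 0))"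
          unfolding shift using pos by (simp add: power2_eq_square field_simps)
        also have "\<dots> \<ge> 0" by (rule insert.prems(3))
        finally show ?thesis .
      qed
    qed
    then obtain vs where "\<And>i j. A i j - v i * v j = (\<Sum>v\<leftarrow>vs. v i * v j)" by blast
    then have "A i j = (\<Sum>v\<leftarrow>v # vs. v i * v j)" for i j
      by (simp add: algebra_simps flip: \<open>\<And>i j. A i j - v i * v j = (\<Sum>v\<leftarrow>vs. v i * v j)\<close>)
    then show ?thesis by blast
  qed
qed

lemma psd_decomposition:
  fixes A :: "real ^ 'n ^ 'n"
  assumes "psd_matrix A"
  obtains vs where "\<And>i j. A $ i $ j = (\<Sum>v\<leftarrow>vs. v i * v j)"
proof -
  have "A $ i $ j = A $ j $ i" for i j
    using assms by (simp add: psd_matrix_def Finite_Cartesian_Product.vec_eq_iff Finite_Cartesian_Product.transpose_def)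
  moreover have "0 \<le> (\<Sum>i\<in>UNIV. \<Sum>j\<in>UNIV. A $ i $ j * x i * x j)" for x
  proof -
    have "0 \<le> (\<chi> i. x i) \<bullet> (A *v (\<chi> i. x i))"
      using assms by (simp add: psd_matrix_def)
    then show ?thesis
      by (simp add: inner_vec_def matrix_vector_mult_def sum_distrib_left mult_ac)
  qed
  ultimately have "\<exists>vs. \<forall>i j. A $ i $ j = (\<Sum>v\<leftarrow>vs. v i * v j)"
    by (intro psd_decomposition_on[of UNIV]) auto
  then show ?thesis using that by blast
qed

section \<open>Sums of squares from Gram matrices\<close>

lemma nc_const_add: "nc_const (a + b) = nc_const a + nc_const b"
  and nc_const_mult: "nc_const (a * b) = nc_const a * nc_const b"
  and nc_const_diff: "nc_const (a - b) = nc_const a - nc_const b"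
  and nc_const_0 [simp]: "nc_const 0 = 0"
  and nc_const_1 [simp]: "nc_const 1 = 1"
  by (rule poly_mapping_eqI; simp add: lookup_add lookup_minus coeff_const lookup_one when_def zero_list_def)+

lemma nc_const_mult_mult:
  "(nc_const a * x) * (nc_const b * y) = nc_const (a * b) * (x * y)"
  by (simp add: nc_const_mult mult.assoc) (metis mult.assoc nc_const_mult_commute)

lemma nc_const_sum_list: "nc_const (\<Sum>v\<leftarrow>vs. f v) = (\<Sum>v\<leftarrow>vs. nc_const (f v))"
  by (induction vs) (auto simp: nc_const_add)

lemma gram_sum_of_squares:
  fixes Y :: "'r::finite \<Rightarrow> 'a nc_poly"
  assumes "\<And>r s. A r s = (\<Sum>v\<leftarrow>vs. v r * v s)"
  shows "(\<Sum>r\<in>UNIV. \<Sum>s\<in>UNIV. nc_const (A r s) * (nc_adjoint (Y r) * Y s)) =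
    (\<Sum>a\<leftarrow>map (\<lambda>v. \<Sum>r\<in>UNIV. nc_const (v r) * Y r) vs. nc_adjoint a * a)"
proof -
  have "(\<Sum>r\<in>UNIV. \<Sum>s\<in>UNIV. (\<Sum>v\<leftarrow>vs. nc_const (v r * v s)) * (nc_adjoint (Y r) * Y s)) =
      (\<Sum>a\<leftarrow>map (\<lambda>v. \<Sum>r\<in>UNIV. nc_const (v r) * Y r) vs. nc_adjoint a * a)"
  proof (induction vs)
    case (Cons v vs)
    have "(\<Sum>r\<in>UNIV. \<Sum>s\<in>UNIV. nc_const (v r * v s) * (nc_adjoint (Y r) * Y s)) =
        nc_adjoint (\<Sum>r\<in>UNIV. nc_const (v r) * Y r) * (\<Sum>r\<in>UNIV. nc_const (v r) * Y r)"
      by (simp only: nc_adjoint_sum nc_adjoint_const_mult sum_product nc_const_mult_mult)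
    with Cons show ?case by (simp add: distrib_right sum.distrib)
  qed simp
  then show ?thesis by (simp only: assms nc_const_sum_list)
qed

section \<open>Polarization of forms and degrees in \<open>h\<close>\<close>

definition h_form :: "real ^ 'g \<Rightarrow> ('g::finite + 'g) nc_poly" where
  "h_form u = (\<Sum>i\<in>UNIV. nc_const (u $ i) * nc_var (Inr i))"

definition x_form :: "real ^ 'g \<Rightarrow> ('g::finite + 'g) nc_poly" where
  "x_form u = (\<Sum>i\<in>UNIV. nc_const (u $ i) * nc_var (Inl i))"

lemma nc_adjoint_forms [simp]: "nc_adjoint (h_form u) = h_form u" "nc_adjoint (x_form u) = x_form u"
  by (simp_all add: h_form_def x_form_def nc_adjoint_sum nc_adjoint_const_mult)

lemma polar_var: "polar k (nc_var j) =
    (if k = 0 then nc_var (Inl j) else if k = 1 then nc_var (Inr j) else 0)"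
proof (rule poly_mapping_eqI)
  fix w :: "('a + 'a) list"
  consider "w = []" | a where "w = [Inl a]" | a where "w = [Inr a]" | a b v where "w = a # b # v"
    by (metis list.exhaust sum.exhaust)
  then show "coeff (polar k (nc_var j)) w =
      coeff (if k = 0 then nc_var (Inl j) else if k = 1 then nc_var (Inr j) else 0) w"
    by cases (auto simp: coeff_polar coeff_var)
qed

lemma polar_linear_form:
  "polar 0 (linear_form u) = x_form u" "polar (Suc 0) (linear_form u) = h_form u"
  "polar 2 (linear_form u) = 0"
  by (simp_all add: linear_form_def x_form_def h_form_def polar_sum polar_const_mult polar_var)

lemma polar_2_quad_poly:
  "polar 2 (quad_poly M) =
     (\<Sum>i\<in>UNIV. \<Sum>j\<in>UNIV. nc_const (M $ i $ j) * (nc_var (Inr i) * nc_var (Inr j)))"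
  unfolding quad_poly_def polar_sum polar_const_mult
  by (simp add: polar_mult polar_var atMost_Suc numeral_2_eq_2)

text \<open>The graded version of \<open>h_linear\<close>, so that factors free of \<open>h\<close>
  can be tracked in products.\<close>

definition h_homogeneous :: "nat \<Rightarrow> ('g + 'g) nc_poly \<Rightarrow> bool" where
  "h_homogeneous k f \<longleftrightarrow> (\<forall>w. coeff f w \<noteq> 0 \<longrightarrow> h_count w = k)"

lemma h_linear_iff: "f \<in> h_linear \<longleftrightarrow> h_homogeneous 1 f"
  by (auto simp: h_linear_def h_homogeneous_def in_keys_iff)

lemma h_homogeneous_polar [intro]: "h_homogeneous k (polar k p)"
  by (auto simp: h_homogeneous_def coeff_polar)

lemma h_homogeneous_zero [intro]: "h_homogeneous k 0"
  by (auto simp: h_homogeneous_def)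

lemma h_homogeneous_add [intro]:
  "h_homogeneous k f \<Longrightarrow> h_homogeneous k g \<Longrightarrow> h_homogeneous k (f + g)"
  unfolding h_homogeneous_def lookup_add by (metis add.right_neutral add_0)

lemma h_homogeneous_const_mult [intro]:
  "h_homogeneous k f \<Longrightarrow> h_homogeneous k (nc_const c * f)"
  by (auto simp: h_homogeneous_def)

lemma h_homogeneous_diff [intro]:
  "h_homogeneous k f \<Longrightarrow> h_homogeneous k g \<Longrightarrow> h_homogeneous k (f - g)"
  unfolding h_homogeneous_def lookup_minus by (metis diff_zero diff_0 neg_equal_0_iff_equal)

lemma h_homogeneous_sum [intro]:
  "(\<And>i. i \<in> I \<Longrightarrow> h_homogeneous k (f i)) \<Longrightarrow> h_homogeneous k (sum f I)"
  by (induction I rule: infinite_finite_induct) auto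

lemma h_homogeneous_mult:
  assumes "h_homogeneous k f" "h_homogeneous l g" "m = k + l"
  shows "h_homogeneous m (f * g)"
  unfolding h_homogeneous_def
proof (intro allI impI)
  fix w assume "coeff (f * g) w \<noteq> 0"
  then obtain n where "coeff f (take n w) * coeff g (drop n w) \<noteq> 0"
    unfolding coeff_mult by (meson sum.not_neutral_contains_not_neutral)
  then have "h_count (take n w) = k" "h_count (drop n w) = l"
    using assms by (auto simp: h_homogeneous_def)
  moreover have "h_count w = h_count (take n w) + h_count (drop n w)"
    by (simp flip: length_append filter_append)
  ultimately show "h_count w = m" using assms(3) by simp
qed

lemma h_homogeneous_forms [intro]:
  "h_homogeneous 0 (x_form u)" "h_homogeneous 1 (h_form u)" "h_homogeneous 1 (nc_var (Inr j))"
  by (metis h_homogeneous_polar polar_linear_form(1), metis h_homogeneous_polar polar_linear_form(2) One_nat_def,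
      auto simp: h_homogeneous_def coeff_var split: if_splits)

lemma psd_gram_sum_of_squares:
  fixes A :: "real ^ 'r ^ 'r" and Y :: "'r::finite \<Rightarrow> ('g + 'g) nc_poly"
  assumes "psd_matrix A" "\<And>r. Y r \<in> h_linear"
  obtains ps where "set ps \<subseteq> h_linear"
    "nc_const 2 * (\<Sum>r\<in>UNIV. \<Sum>s\<in>UNIV. nc_const (A $ r $ s) * (nc_adjoint (Y r) * Y s)) =
       (\<Sum>a\<leftarrow>ps. nc_adjoint a * a)"
proof -
  obtain vs where vs: "\<And>i j. A $ i $ j = (\<Sum>v\<leftarrow>vs. v i * v j)"
    using psd_decomposition[OF assms(1)] by blast
  \<comment> \<open>The \<open>sqrt 2\<close> absorbs the factor two of the Hessian.\<close>
  define ws where "ws = map (\<lambda>v r. sqrt 2 * v r) vs"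
  have "(\<Sum>v\<leftarrow>ws. v r * v s) = 2 * (\<Sum>v\<leftarrow>vs. v r * v s)" for r s
    unfolding ws_def by (induction vs) (auto simp: algebra_simps)
  then have "2 * A $ r $ s = (\<Sum>v\<leftarrow>ws. v r * v s)" for r s
    by (simp add: vs)
  note gram_sum_of_squares[of "\<lambda>r s. 2 * A $ r $ s", OF this, of Y]
  moreover have "nc_const 2 * (\<Sum>r\<in>UNIV. \<Sum>s\<in>UNIV. nc_const (A $ r $ s) * (nc_adjoint (Y r) * Y s)) =
      (\<Sum>r\<in>UNIV. \<Sum>s\<in>UNIV. nc_const (2 * A $ r $ s) * (nc_adjoint (Y r) * Y s))"
    by (simp add: nc_const_mult sum_distrib_left mult.assoc)
  moreover have "set (map (\<lambda>v. \<Sum>r\<in>UNIV. nc_const (v r) * Y r) ws) \<subseteq> h_linear"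
    using assms(2) unfolding h_linear_iff
    by (auto simp: h_linear_iff simp del: One_nat_def intro!: h_homogeneous_sum h_homogeneous_const_mult)
  ultimately show ?thesis using that by metis
qed

lemma sigma_le_1_of_polar:
  assumes "set ps \<subseteq> h_linear" "h_homogeneous 1 a" "h_homogeneous 1 b"
    and "nc_const 2 * G = (\<Sum>a\<leftarrow>ps. nc_adjoint a * a)"
    and "polar 2 p = G + nc_adjoint a * b + nc_adjoint b * a"
  shows "sigma_minus_min_hessian p \<le> 1"
proof -
  have two: "nc_const 2 * x = x + x" for x :: "('a + 'a) nc_poly"
    using nc_const_add[of 1 1, where 'a = "'a + 'a"] by (simp add: mult_2)
  have "nc_hessian p = (\<Sum>a\<leftarrow>ps @ [a + b]. nc_adjoint a * a) - (\<Sum>b\<leftarrow>[a - b]. nc_adjoint b * b)"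
    by (simp add: nc_hessian_eq_polar assms(5) distrib_left flip: assms(4))
      (simp add: two nc_adjoint_add nc_adjoint_diff algebra_simps)
  then have "sds_over h_linear (ps @ [a + b]) [a - b] (nc_hessian p)"
    using assms(1-3) by (auto simp: sds_over_def h_linear_iff)
  then have "sigma_minus_min_over h_linear (nc_hessian p) \<le> enat 1"
    unfolding sigma_minus_min_over_le_iff by (intro exI[of _ "ps @ [a + b]"] exI[of _ "[a - b]"]) auto
  then show ?thesis by (simp add: sigma_minus_min_hessian_def one_enat_def)
qed

section \<open>Quadratic forms in \<open>h\<close> and their compression by the projection\<close>

definition h_quad :: "real ^ 'g ^ 'g \<Rightarrow> ('g::finite + 'g) nc_poly" where
  "h_quad M = (\<Sum>i\<in>UNIV. \<Sum>j\<in>UNIV. nc_const (M $ i $ j) * (nc_var (Inr i) * nc_var (Inr j)))"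

lemma nc_adjoint_h_quad: "nc_adjoint (h_quad M) = h_quad (Finite_Cartesian_Product.transpose M)"
  unfolding h_quad_def nc_adjoint_sum nc_adjoint_const_mult
  unfolding nc_adjoint_mult nc_adjoint_var
  by (subst sum.swap) (simp add: Finite_Cartesian_Product.transpose_def)

lemma polar_2_homogeneous: "nc_homogeneous 2 a \<Longrightarrow> polar 2 a = h_quad (coeff_matrix a)"
  using polar_2_quad_poly[of "coeff_matrix a"] by (simp add: quad_poly_coeff_matrix h_quad_def)

text \<open>The projection removes \<open>u u\<^sup>T M\<close>, whose quadratic form is \<phi>(h)
  times the linear form with coefficients \<open>u\<^sup>T M\<close>.\<close>

lemma h_quad_proj_orth:
  obtains L where "h_homogeneous 1 L" "h_quad (proj_orth u ** M) = h_quad M - h_form u * L"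
proof
  define c where "c j = (\<Sum>k\<in>UNIV. u $ k * M $ k $ j)" for j
  let ?L = "\<Sum>j\<in>UNIV. nc_const (c j) * nc_var (Inr j)"
  have "(proj_orth u ** M) $ i $ j = M $ i $ j - u $ i * c j" for i j
    using sum_delta_minus[of i "\<lambda>k. u $ i * u $ k" "\<lambda>k. M $ k $ j"]
    by (simp add: matrix_matrix_mult_def proj_orth_nth eq_commute[of i] c_def sum_distrib_left mult_ac)
  then have "h_quad (proj_orth u ** M) =
      h_quad M - (\<Sum>i\<in>UNIV. \<Sum>j\<in>UNIV. nc_const (u $ i * c j) * (nc_var (Inr i) * nc_var (Inr j)))"
    by (simp add: h_quad_def nc_const_diff left_diff_distrib sum_subtractf)
  also have "(\<Sum>i\<in>UNIV. \<Sum>j\<in>UNIV. nc_const (u $ i * c j) * (nc_var (Inr i) * nc_var (Inr j))) =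
      h_form u * ?L"
    unfolding h_form_def sum_product nc_const_mult_mult ..
  finally show "h_quad (proj_orth u ** M) = h_quad M - h_form u * ?L" .
  show "h_homogeneous 1 ?L"
    by (intro h_homogeneous_sum h_homogeneous_const_mult h_homogeneous_forms)
qed

text \<open>In \<open>polar 2 p\<close> every term other than the Gram form of \<open>E2\<close> on the vectors \<open>h\<close> and \<open>h \<phi>(x)\<close> has
  \<open>\<phi>(h)\<close> as a left or right factor, so they combine to \<open>\<phi>(h) T + T\<^sup>T \<phi>(h)\<close>, which costs a single
  negative square.\<close>

lemma sigma_le_1_of_canonical_form:
  fixes p :: "'g::finite nc_poly"
  assumes "canonical_form p u p0 p1 p2 q f0"
  shows "sigma_minus_min_hessian p \<le> 1"
proof -
  let ?x = "x_form u" and ?h = "h_form u" and ?T = "Finite_Cartesian_Product.transpose"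
  let ?M = "coeff_matrix p2" and ?Q = "coeff_matrix q" and ?F = "coeff_matrix f0"
  let ?E = "E2 u p2 q f0" and ?half = "nc_const (1/2) :: ('g + 'g) nc_poly"
  define Y where "Y = case_sum (\<lambda>i. nc_var (Inr i)) (\<lambda>i. nc_var (Inr i) * ?x)"
  have p: "p = p0 + p1 + p2 + linear_form u * q + nc_adjoint (linear_form u * q)
      + linear_form u * f0 * linear_form u"
    and hom: "nc_homogeneous 0 p0" "nc_homogeneous 1 p1" "nc_homogeneous 2 p2"
      "nc_homogeneous 2 q" "nc_homogeneous 2 f0"
    and sym: "nc_adjoint p2 = p2"
    and psd: "psd_matrix ?E"
    using assms by (simp_all add: canonical_form_def Let_def nc_symmetric_def nc_adjoint_mult)
  \<comment> \<open>Symmetry of \<open>f0\<close> is not a clause of \<open>canonical_form\<close>;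
    it is read off the lower right block of \<open>E2\<close>.\<close>
  have "?T ?E = ?E" using psd by (simp add: psd_matrix_def)
  then have "?T ?E $ Inr i $ Inr j = ?E $ Inr i $ Inr j" for i j by simp
  then have f0_sym: "coeff f0 [j, i] = coeff f0 [i, j]" for i j
    by (simp add: E2_def Let_def block_matrix_def Finite_Cartesian_Product.transpose_def coeff_matrix_def)
  have f0: "nc_adjoint f0 = f0"
  proof -
    have "coeff f0 (rev w) = coeff f0 w" for w
    proof (cases "length w = 2")
      case True
      then obtain i j where "w = [i, j]" by (auto simp: length_Suc_conv numeral_2_eq_2)
      then show ?thesis using f0_sym[of i j] by simp
    next
      case False
      then show ?thesis using hom(5) by (metis length_rev nc_homogeneous_iff)
    qed
    then show ?thesis by (intro poly_mapping_eqI) simp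
  qed
  have TM: "?T ?M = ?M"
  proof -
    have "coeff p2 [j, i] = coeff p2 [i, j]" for i j
      using arg_cong[OF sym, of "\<lambda>a. coeff a [i, j]"] by simp
    then show ?thesis
      by (simp add: Finite_Cartesian_Product.vec_eq_iff Finite_Cartesian_Product.transpose_def coeff_matrix_def)
  qed

  obtain L1 where L1: "h_homogeneous 1 L1" "h_quad (proj_orth u ** ?T ?Q) = h_quad (?T ?Q) - ?h * L1"
    using h_quad_proj_orth by blast
  obtain L2 where L2: "h_homogeneous 1 L2"
    "h_quad (proj_orth u ** (?M ** proj_orth u)) = h_quad (?M ** proj_orth u) - ?h * L2"
    using h_quad_proj_orth by blast
  obtain L3 where L3: "h_homogeneous 1 L3" "h_quad (proj_orth u ** ?M) = h_quad ?M - ?h * L3"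
    using h_quad_proj_orth by blast
  have QP: "h_quad (?Q ** proj_orth u) = h_quad ?Q - nc_adjoint L1 * ?h"
    using arg_cong[OF L1(2), of nc_adjoint]
    by (simp add: nc_adjoint_h_quad matrix_transpose_mul nc_adjoint_diff nc_adjoint_mult)
  have MP: "h_quad (?M ** proj_orth u) = h_quad ?M - nc_adjoint L3 * ?h"
    using arg_cong[OF L3(2), of nc_adjoint]
    by (simp add: nc_adjoint_h_quad matrix_transpose_mul nc_adjoint_diff nc_adjoint_mult TM)
  \<comment> \<open>This is what compressing \<open>?M\<close> from both sides removes.\<close>
  define K where "K = nc_adjoint L3 * ?h + ?h * L2"
  have PMP: "h_quad (proj_orth u ** ?M ** proj_orth u) = h_quad ?M - K"
    using L2(2) MP by (simp add: matrix_mul_assoc K_def)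
  have "h_quad (proj_orth u ** ?M ** proj_orth u) = h_quad ?M - nc_adjoint K"
    using arg_cong[OF PMP, of nc_adjoint]
    by (simp add: nc_adjoint_h_quad matrix_transpose_mul matrix_mul_assoc nc_adjoint_diff TM)
  then have "nc_adjoint K = K"
    unfolding PMP by (rule diff_left_imp_eq[symmetric])
  have half: "?half * z + ?half * z = z" for z
    using nc_const_add[of "1/2" "1/2", where 'a = "'g + 'g"] by (simp flip: distrib_right)
  have half': "z * (?half * y) = ?half * (z * y)" for y z
    by (metis mult.assoc nc_const_mult_commute)
  \<comment> \<open>As \<open>K\<close> is its own adjoint, it equals the mean of \<open>K\<close>
    and its adjoint, and the mean has \<phi>(h) outside with the same cofactor on both
    sides.\<close>
  define L where "L = ?half * (L2 + L3)"
  have "K = ?half * (K + nc_adjoint K)"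
    using \<open>nc_adjoint K = K\<close> half[of K] by (simp add: distrib_left)
  also have "\<dots> = ?h * L + nc_adjoint L * ?h"
    by (simp add: K_def L_def nc_adjoint_add nc_adjoint_mult nc_adjoint_const_mult algebra_simps half')
  finally have K: "K = ?h * L + nc_adjoint L * ?h" .

  define G where "G = (\<Sum>r\<in>UNIV. \<Sum>s\<in>UNIV. nc_const (?E $ r $ s) * (nc_adjoint (Y r) * Y s))"
  have G: "G = h_quad (proj_orth u ** ?M ** proj_orth u) + h_quad (proj_orth u ** ?T ?Q) * ?x +
      ?x * h_quad (?Q ** proj_orth u) + ?x * h_quad ?F * ?x"
  proof -
    have c: "?x * (nc_const c * z) = nc_const c * (?x * z)" for c z
      by (metis mult.assoc nc_const_mult_commute)
    show ?thesis
      by (simp add: G_def sum_UNIV_sum E2_def Let_def block_matrix_def Y_def h_quad_def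
          sum_distrib_left sum_distrib_right sum.distrib nc_adjoint_mult c mult.assoc add.assoc)
  qed
  \<comment> \<open>The cofactor of \<phi>(h): \<open>L\<close> and \<open>L1 * ?x\<close> repair
    the projections, the next two terms have one \<open>h\<close> in an outer \<phi> and one in
    \<open>q\<close> or \<open>f0\<close>, and the self-adjoint term with both \<open>h\<close> in
    the outer factors is split into halves.\<close>
  define T where "T = L + L1 * ?x + polar 1 q + polar 1 f0 * ?x + ?half * (polar 0 f0 * ?h)"

  have "polar 2 (linear_form u * q) = ?x * h_quad ?Q + ?h * polar 1 q"
    by (simp add: polar_mult numeral_2_eq_2 atMost_Suc polar_linear_form[unfolded numeral_2_eq_2]
        polar_2_homogeneous[unfolded numeral_2_eq_2, OF hom(4)[unfolded numeral_2_eq_2]])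
  moreover have "polar 2 (linear_form u * f0 * linear_form u) =
      ?x * h_quad ?F * ?x + ?x * polar 1 f0 * ?h + ?h * polar 1 f0 * ?x + ?h * polar 0 f0 * ?h"
    by (simp add: polar_mult numeral_2_eq_2 atMost_Suc polar_linear_form[unfolded numeral_2_eq_2]
        polar_2_homogeneous[unfolded numeral_2_eq_2, OF hom(5)[unfolded numeral_2_eq_2]] algebra_simps)
  ultimately have "polar 2 p = h_quad ?M + (?x * h_quad ?Q + ?h * polar 1 q) +
      nc_adjoint (?x * h_quad ?Q + ?h * polar 1 q) +
      (?x * h_quad ?F * ?x + ?x * polar 1 f0 * ?h + ?h * polar 1 f0 * ?x + ?h * polar 0 f0 * ?h)"
    unfolding p by (simp add: polar_add polar_adjoint polar_eq_0[OF hom(1)] polar_eq_0[OF hom(2)]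
        polar_2_homogeneous[OF hom(3)])
  moreover have "nc_adjoint (polar k f0) = polar k f0" for k
    by (metis f0 polar_adjoint)
  moreover have "?h * (polar 0 f0 * ?h) = ?half * (?h * (polar 0 f0 * ?h)) + ?half * (?h * (polar 0 f0 * ?h))"
    by (simp add: half)
  ultimately have "polar 2 p = G + nc_adjoint ?h * T + nc_adjoint T * ?h"
    unfolding G PMP K L1(2) QP T_def
    by (simp add: nc_adjoint_add nc_adjoint_mult nc_adjoint_const_mult nc_adjoint_h_quad
        algebra_simps half')
  moreover have "h_homogeneous 1 T"
  proof -
    have x: "h_homogeneous 1 (z * ?x)" if "h_homogeneous 1 z" for z
      using h_homogeneous_mult[OF that h_homogeneous_forms(1)] by simp
    have h: "h_homogeneous 1 (polar 0 f0 * ?h)"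
      by (rule h_homogeneous_mult[OF h_homogeneous_polar h_homogeneous_forms(2)]) simp
    show ?thesis
      unfolding T_def L_def
      by (intro h_homogeneous_add h_homogeneous_const_mult h_homogeneous_polar x h L1(1) L2(1) L3(1))
  qed
  moreover have "Y r \<in> h_linear" for r
  proof -
    have "h_homogeneous 1 (nc_var (Inr j) * ?x)" for j
      by (rule h_homogeneous_mult[OF h_homogeneous_forms(3,1)]) simp
    then show ?thesis
      using h_homogeneous_forms(3) unfolding Y_def h_linear_iff by (cases r) simp_all
  qed
  then obtain ps where "set ps \<subseteq> h_linear" "nc_const 2 * G = (\<Sum>a\<leftarrow>ps. nc_adjoint a * a)"
    unfolding G_def by (rule psd_gram_sum_of_squares[OF psd])
  ultimately show ?thesis
    using sigma_le_1_of_polar[OF _ h_homogeneous_forms(2)] by blast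
qed

section \<open>Evaluation of quadratic polynomials\<close>

lemma sum_keys_quadratic:
  fixes a :: "'g::finite nc_poly"
  assumes "nc_homogeneous 2 a"
  shows "(\<Sum>w\<in>Poly_Mapping.keys a. coeff a w * f w) =
    (\<Sum>i\<in>UNIV. \<Sum>j\<in>UNIV. coeff_matrix a $ i $ j * f [i, j])"
proof -
  let ?W = "range (\<lambda>(i::'g, j::'g). [i, j])"
  have "(\<Sum>w\<in>Poly_Mapping.keys a. coeff a w * f w) = (\<Sum>w\<in>?W. coeff a w * f w)"
  proof (rule sum.mono_neutral_left)
    show "Poly_Mapping.keys a \<subseteq> ?W"
    proof
      fix w assume "w \<in> Poly_Mapping.keys a"
      then have "length w = 2" using assms by (simp add: nc_homogeneous_def)
      then obtain i j where "w = [i, j]" by (auto simp: length_Suc_conv numeral_2_eq_2)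
      then show "w \<in> ?W" by auto
    qed
  qed (auto simp: in_keys_iff)
  also have "\<dots> = (\<Sum>i\<in>UNIV. \<Sum>j\<in>UNIV. coeff a [i, j] * f [i, j])"
    by (subst sum.reindex) (auto simp: inj_on_def sum.cartesian_product case_prod_unfold)
  finally show ?thesis by (simp add: coeff_matrix_def)
qed

lemma nc_eval_quadratic:
  fixes a :: "'g::finite nc_poly"
  assumes "nc_homogeneous 2 a" "\<And>j. X j \<in> carrier_mat n n" "r < n" "c < n"
  shows "nc_eval n X a $$ (r, c) = (\<Sum>i\<in>UNIV. \<Sum>j\<in>UNIV. coeff_matrix a $ i $ j *
    (\<Sum>k\<in>{0..<n}. X i $$ (r, k) * X j $$ (k, c)))"
proof -
  have "foldr (\<lambda>j M. X j * M) [i, j] (1\<^sub>m n) $$ (r, c) = (\<Sum>k\<in>{0..<n}. X i $$ (r, k) * X j $$ (k, c))"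
    for i j
    using assms(2)[of i] assms(2)[of j] assms(3,4) by (simp add: scalar_prod_def)
  then show ?thesis
    unfolding nc_eval_def using assms(3,4)
    by (simp add: sum_keys_quadratic[OF assms(1)])
qed

lemma sym_mats_index: "A \<in> sym_mats n \<Longrightarrow> i < n \<Longrightarrow> j < n \<Longrightarrow> A $$ (i, j) = A $$ (j, i)"
  unfolding sym_mats_def by (metis (mono_tags, lifting) carrier_matD index_transpose_mat(1) mem_Collect_eq)

lemma quadratic_form_index:
  fixes A :: "real mat"
  assumes "A \<in> carrier_mat n n" "v \<in> carrier_vec n"
  shows "scalar_prod v (A *\<^sub>v v) = (\<Sum>r\<in>{0..<n}. \<Sum>c\<in>{0..<n}. vec_index v r * vec_index v c * A $$ (r, c))"
  using assms by (simp add: scalar_prod_def sum_distrib_left mult_ac)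

text \<open>If \<open>y k\<close> collects the entries number \<open>k\<close> of the vectors
  \<open>X i v\<close>, then the value at \<open>v\<close> is the sum over \<open>k\<close> of the
  coefficient form at \<open>y k\<close>; symmetry of the \<open>X i\<close> moves the left factor
  onto \<open>v\<close>.\<close>

lemma psd_nc_eval:
  fixes a :: "'g::finite nc_poly"
  assumes hom: "nc_homogeneous 2 a" and psd: "psd_matrix (coeff_matrix a)"
    and X: "\<And>j. X j \<in> sym_mats n"
  shows "psd_mat n (nc_eval n X a)"
proof -
  let ?M = "coeff_matrix a" and ?A = "nc_eval n X a"
  have C: "X j \<in> carrier_mat n n" for j using X by (simp add: sym_mats_def)
  have A: "?A \<in> carrier_mat n n" by (simp add: nc_eval_def)
  have M: "?M $ i $ j = ?M $ j $ i" for i j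
    using psd unfolding psd_matrix_def
    by (metis (no_types, lifting) Finite_Cartesian_Product.transpose_def vec_lambda_beta)
  note entry = nc_eval_quadratic[OF hom C]
  have "?A $$ (c, r) = ?A $$ (r, c)" if "r < n" "c < n" for r c
  proof -
    have "(\<Sum>k\<in>{0..<n}. X i $$ (c, k) * X j $$ (k, r)) = (\<Sum>k\<in>{0..<n}. X j $$ (r, k) * X i $$ (k, c))" for i j
      using that sym_mats_index[OF X] by (intro sum.cong) auto
    then show ?thesis
      unfolding entry[OF that] entry[OF that(2,1)]
      by (subst sum.swap) (simp add: M[of _ _])
  qed
  then have "?A \<in> sym_mats n"
    using A by (auto simp: sym_mats_def intro!: eq_matI)
  moreover have "0 \<le> scalar_prod v (?A *\<^sub>v v)" if v: "v \<in> carrier_vec n" for v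
  proof -
    define y where "y k = (\<chi> i. \<Sum>r\<in>{0..<n}. vec_index v r * X i $$ (r, k))" for k
    have y: "(\<Sum>c\<in>{0..<n}. vec_index v c * X j $$ (k, c)) = y k $ j" if "k < n" for k j
      unfolding y_def using sym_mats_index[OF X] that by (auto intro: sum.cong)
    have inner: "(\<Sum>r\<in>{0..<n}. \<Sum>c\<in>{0..<n}. \<Sum>k\<in>{0..<n}.
        vec_index v r * (vec_index v c * (?M $ i $ j * (X i $$ (r, k) * X j $$ (k, c))))) =
        (\<Sum>k\<in>{0..<n}. ?M $ i $ j * (y k $ i * y k $ j))" for i j
    proof -
      have "(\<Sum>r\<in>{0..<n}. \<Sum>c\<in>{0..<n}. \<Sum>k\<in>{0..<n}.
          vec_index v r * (vec_index v c * (?M $ i $ j * (X i $$ (r, k) * X j $$ (k, c))))) =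
          (\<Sum>r\<in>{0..<n}. \<Sum>k\<in>{0..<n}. \<Sum>c\<in>{0..<n}.
          vec_index v r * (vec_index v c * (?M $ i $ j * (X i $$ (r, k) * X j $$ (k, c)))))"
        by (rule sum.cong[OF refl]) (rule sum.swap)
      also have "\<dots> = (\<Sum>k\<in>{0..<n}. \<Sum>r\<in>{0..<n}. \<Sum>c\<in>{0..<n}.
          vec_index v r * (vec_index v c * (?M $ i $ j * (X i $$ (r, k) * X j $$ (k, c)))))"
        by (rule sum.swap)
      also have "\<dots> = (\<Sum>k\<in>{0..<n}. ?M $ i $ j * ((\<Sum>r\<in>{0..<n}. vec_index v r * X i $$ (r, k)) *
          (\<Sum>c\<in>{0..<n}. vec_index v c * X j $$ (k, c))))"
        unfolding sum_product unfolding sum_distrib_left by (intro sum.cong refl) simp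
      also have "\<dots> = (\<Sum>k\<in>{0..<n}. ?M $ i $ j * (y k $ i * y k $ j))"
        by (rule sum.cong) (simp_all add: y, simp add: y_def)
      finally show ?thesis .
    qed
    have "scalar_prod v (?A *\<^sub>v v) = (\<Sum>r\<in>{0..<n}. \<Sum>c\<in>{0..<n}. \<Sum>i\<in>UNIV. \<Sum>j\<in>UNIV. \<Sum>k\<in>{0..<n}.
        vec_index v r * (vec_index v c * (?M $ i $ j * (X i $$ (r, k) * X j $$ (k, c)))))"
      unfolding quadratic_form_index[OF A v]
      by (intro sum.cong refl) (simp add: entry sum_distrib_left mult.assoc)
    also have "\<dots> = (\<Sum>i\<in>UNIV. \<Sum>j\<in>UNIV. \<Sum>r\<in>{0..<n}. \<Sum>c\<in>{0..<n}. \<Sum>k\<in>{0..<n}.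
        vec_index v r * (vec_index v c * (?M $ i $ j * (X i $$ (r, k) * X j $$ (k, c)))))"
      by (simp only: sum.swap[where A = "{0..<n}" and B = "UNIV :: 'g set"])
    also have "\<dots> = (\<Sum>i\<in>UNIV. \<Sum>j\<in>UNIV. \<Sum>k\<in>{0..<n}. ?M $ i $ j * (y k $ i * y k $ j))"
      by (simp only: inner)
    also have "\<dots> = (\<Sum>k\<in>{0..<n}. \<Sum>i\<in>UNIV. \<Sum>j\<in>UNIV. ?M $ i $ j * (y k $ i * y k $ j))"
      by (simp only: sum.swap[where A = "{0..<n}" and B = "UNIV :: 'g set"])
    also have "\<dots> = (\<Sum>k\<in>{0..<n}. y k \<bullet> (?M *v y k))"
      by (simp add: inner_vec_def matrix_vector_mult_def sum_distrib_left mult_ac)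
    also have "\<dots> \<ge> 0" using psd by (intro sum_nonneg) (simp add: psd_matrix_def)
    finally show ?thesis .
  qed
  ultimately show ?thesis by (simp add: psd_mat_def)
qed

text \<open>Commuting arguments suffice here: tuples of \<open>1 \<times> 1\<close> matrices already detect positivity of the
  coefficient matrix.\<close>

lemma psd_coeff_matrix_of_eval:
  fixes a :: "'g::finite nc_poly"
  assumes hom: "nc_homogeneous 2 a" and sym: "nc_symmetric a"
    and psd: "\<And>X. (\<And>j. X j \<in> sym_mats 1) \<Longrightarrow> psd_mat 1 (nc_eval 1 X a)"
  shows "psd_matrix (coeff_matrix a)"
proof -
  have "coeff a [i, j] = coeff a [j, i]" for i j
    using sym[unfolded nc_symmetric_iff, rule_format, of "[j, i]"] by simp
  then have "Finite_Cartesian_Product.transpose (coeff_matrix a) = coeff_matrix a"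
    by (simp add: Finite_Cartesian_Product.vec_eq_iff Finite_Cartesian_Product.transpose_def coeff_matrix_def)
  moreover have "0 \<le> x \<bullet> (coeff_matrix a *v x)" for x
  proof -
    define X where "X j = Matrix.mat 1 1 (\<lambda>_. x $ j)" for j
    define v where "v = Matrix.vec 1 (\<lambda>_. 1 :: real)"
    have X: "X j \<in> sym_mats 1" for j
      by (auto simp: X_def sym_mats_def intro!: eq_matI)
    then have C: "X j \<in> carrier_mat 1 1" for j by (simp add: sym_mats_def)
    have v: "v \<in> carrier_vec 1" by (simp add: v_def)
    have A: "nc_eval 1 X a \<in> carrier_mat 1 1" by (simp add: nc_eval_def)
    have "0 \<le> scalar_prod v (nc_eval 1 X a *\<^sub>v v)"
      using psd[OF X] v by (simp add: psd_mat_def)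
    also have "\<dots> = nc_eval 1 X a $$ (0, 0)"
      unfolding quadratic_form_index[OF A v] by (simp add: v_def)
    also have "\<dots> = x \<bullet> (coeff_matrix a *v x)"
      by (subst nc_eval_quadratic[OF hom C])
        (simp_all add: X_def inner_vec_def matrix_vector_mult_def sum_distrib_left mult_ac)
    finally show ?thesis .
  qed
  ultimately show ?thesis by (simp add: psd_matrix_def)
qed

section \<open>No negative squares\<close>

text \<open>Without a hyperplane single letters are allowed as test vectors, so a top word is cut
  after one letter and 2 (d - 1) > d gives the bound.\<close>

lemma degree_le_2_of_hankel_nonneg:
  fixes p :: "'g::finite nc_poly"
  assumes "nc_symmetric p" and nonneg: "\<And>y. 0 \<le> hankel p y y"
  shows "nc_degree p \<le> 2"
proof (rule ccontr)
  assume d: "\<not> nc_degree p \<le> 2"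
  then obtain w where w: "length w = nc_degree p" "coeff p w \<noteq> 0"
    using degree_attained[of p] by auto
  with d obtain i z where iz: "w = i # z" by (cases w) auto
  have z: "z \<in> hankel_words p" "nc_degree p \<le> Suc (length z)" "nc_degree p < 2 * length z"
    using w d by (auto simp: iz hankel_words_def)
  have "hankel p (unit_word [i]) (unit_word z) = 0"
    by (rule hankel_isotropic[OF assms(1) hankel_unit_word_self_eq_0[OF z(1,3)]]) (rule nonneg)
  then have "(\<Sum>k\<in>UNIV. coeff p (k # z) * unit_word [i] [k]) = 0"
    by (simp add: hankel_unit_word_top[OF z(1,2)])
  then have "coeff p w = 0"
    by (simp add: unit_word_def iz if_distrib[of "\<lambda>x. _ * x"] cong: if_cong)
  with w show False by simp
qed

lemma hom_part_symmetric: "nc_symmetric p \<Longrightarrow> nc_symmetric (nc_hom_part k p)"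
  by (simp add: nc_symmetric_iff coeff_hom_part)

lemma hom_part_homogeneous: "nc_homogeneous k (nc_hom_part k p)"
  by (simp add: nc_homogeneous_iff coeff_hom_part)

lemma psd_of_hankel_nonneg:
  fixes p :: "'g::finite nc_poly"
  assumes "nc_symmetric p" and nonneg: "\<And>y. 0 \<le> hankel p y y"
  shows "psd_matrix (coeff_matrix (nc_hom_part 2 p))"
proof -
  have "coeff p [i, j] = coeff p [j, i]" for i j
    using assms(1)[unfolded nc_symmetric_iff, rule_format, of "[j, i]"] by simp
  moreover have "0 \<le> v \<bullet> (coeff_matrix (nc_hom_part 2 p) *v v)" for v
    using nonneg[of "test_vec v 0"]
    by (simp add: hankel_test_vec inner_vec_def matrix_vector_mult_def coeff_matrix_def
        coeff_hom_part sum_distrib_left mult_ac)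
  ultimately show ?thesis
    by (simp add: psd_matrix_def Finite_Cartesian_Product.vec_eq_iff
        Finite_Cartesian_Product.transpose_def coeff_matrix_def coeff_hom_part)
qed

text \<open>In degree at most two both letters of a surviving word are \<open>h\<close>, so the
  Hessian is twice a quadratic form in \<open>h\<close> alone.\<close>

lemma sigma_0_of_psd:
  fixes p :: "'g::finite nc_poly"
  assumes "nc_degree p \<le> 2" "psd_matrix (coeff_matrix (nc_hom_part 2 p))"
  shows "sigma_minus_min_hessian p = 0"
proof -
  have "polar 2 p = polar 2 (nc_hom_part 2 p)"
  proof (rule poly_mapping_eqI)
    fix w :: "('g + 'g) list"
    have "coeff p (merge w) = 0" if "h_count w = 2" "length w \<noteq> 2"
    proof -
      have "2 < length w" using that length_filter_le[of "\<lambda>v. \<not> isl v" w] by linarith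
      with assms(1) show ?thesis by (intro coeff_beyond_degree) simp
    qed
    then show "coeff (polar 2 p) w = coeff (polar 2 (nc_hom_part 2 p)) w"
      by (auto simp: coeff_polar coeff_hom_part)
  qed
  then have hess: "nc_hessian p = nc_const 2 * h_quad (coeff_matrix (nc_hom_part 2 p))"
    by (simp add: nc_hessian_eq_polar polar_2_homogeneous hom_part_homogeneous)
  define Y where "Y j = (nc_var (Inr j) :: ('g + 'g) nc_poly)" for j
  have "Y j \<in> h_linear" for j
    unfolding h_linear_iff Y_def by (rule h_homogeneous_forms)
  then obtain ps where "set ps \<subseteq> h_linear"
    "nc_const 2 * h_quad (coeff_matrix (nc_hom_part 2 p)) = (\<Sum>a\<leftarrow>ps. nc_adjoint a * a)"
    using psd_gram_sum_of_squares[OF assms(2), of Y]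
    unfolding h_quad_def by (simp add: Y_def) blast
  then have "sds_over h_linear ps [] (nc_hessian p)"
    by (simp add: sds_over_def hess)
  then have "sigma_minus_min_over h_linear (nc_hessian p) \<le> enat 0"
    unfolding sigma_minus_min_over_le_iff by (intro exI[of _ ps] exI[of _ "[]"]) simp
  then show ?thesis by (simp add: sigma_minus_min_hessian_def zero_enat_def[symmetric])
qed

section \<open>Degree three\<close>

text \<open>Without a part of degree four \<open>f0\<close> vanishes; a positive semidefinite matrix
  with a zero diagonal block has zero blocks beside it, so \<open>Q(q) P = 0\<close> and
  \<open>Q(q)\<close> equals \<open>Q(q) u u\<^sup>T\<close>.\<close>

lemma canonical_form_degree_3:
  fixes p :: "'g::finite nc_poly"
  assumes "canonical_form p u p0 p1 p2 q f0" "nc_degree p = 3"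
  shows "f0 = 0 \<and> (\<exists>f1. f1 \<noteq> 0 \<and> nc_homogeneous 1 f1 \<and> q = f1 * linear_form u)"
proof -
  have p: "p = p0 + p1 + p2 + linear_form u * q + nc_adjoint q * linear_form u
      + linear_form u * f0 * linear_form u"
    and hom: "nc_homogeneous 0 p0" "nc_homogeneous 1 p1" "nc_homogeneous 2 p2"
      "nc_homogeneous 2 q" "nc_homogeneous 2 f0"
    and u: "norm u = 1" and psd: "psd_matrix (E2 u p2 q f0)"
    using assms by (simp_all add: canonical_form_def Let_def)
  have low: "coeff p0 w = 0" "coeff p1 w = 0" "coeff p2 w = 0" if "2 < length w" for w
    using hom that unfolding nc_homogeneous_iff by fastforce+
  have "u \<noteq> 0" using u by auto
  then obtain j where j: "u $ j \<noteq> 0"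
    by (auto simp: Finite_Cartesian_Product.vec_eq_iff)
  have "coeff f0 w = 0" for w
  proof (cases "length w = 2")
    case True
    \<comment> \<open>At the word \<open>j # w @ [j]\<close> of length four only the summand with
      \<open>f0\<close> contributes, and \<open>u $ j\<close> is not zero.\<close>
    have "coeff q (w @ [j]) = 0" "coeff (nc_adjoint q) (j # w) = 0"
      using hom(4) True by (auto simp: nc_homogeneous_iff)
    moreover have "coeff p (j # w @ [j]) = 0"
      using assms(2) True by (intro coeff_beyond_degree) simp
    ultimately have "u $ j * coeff f0 w * u $ j = 0"
      using True by (subst (asm) p) (simp add: lookup_add low coeff_linear_form_mult coeff_mult_linear_form
          butlast_append)
    then show ?thesis using j by simp
  next
    case False
    then show ?thesis using hom(5) by (auto simp: nc_homogeneous_iff)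
  qed
  then have f0: "f0 = 0" by (intro poly_mapping_eqI) simp
  have quad: "0 \<le> (proj_orth u *v a) \<bullet> (coeff_matrix p2 *v (proj_orth u *v a)) +
      2 * (b \<bullet> (coeff_matrix q *v (proj_orth u *v a))) + b \<bullet> (coeff_matrix f0 *v b)" for a b
    using psd unfolding psd_E2_iff by blast
  have "coeff_matrix q *v (proj_orth u *v a) = 0" for a
  proof -
    \<comment> \<open>Testing with multiples of \<open>?b\<close> gives a form that is affine in the
      multiple, since its quadratic term belongs to \<open>f0\<close>.\<close>
    let ?b = "coeff_matrix q *v (proj_orth u *v a)"
    have "?b \<bullet> ?b = 0"
    proof (rule affine_nonneg_slope_0)
      fix t
      have "coeff_matrix f0 = 0"
        by (simp add: f0 coeff_matrix_def Finite_Cartesian_Product.vec_eq_iff)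
      then show "0 \<le> (proj_orth u *v a) \<bullet> (coeff_matrix p2 *v (proj_orth u *v a)) + 2 * t * (?b \<bullet> ?b)"
        using quad[of a "t *\<^sub>R ?b"] by (simp add: mult.assoc)
    qed
    then show ?thesis by simp
  qed
  then have "coeff_matrix q *v a - (u \<bullet> a) *\<^sub>R (coeff_matrix q *v u) = 0" for a
    unfolding proj_orth_mult_vec matrix_vector_mult_diff_distrib matrix_vector_mult_scaleR .
  then have Q: "coeff_matrix q *v a = (u \<bullet> a) *\<^sub>R (coeff_matrix q *v u)" for a
    unfolding right_minus_eq .
  define f1 where "f1 = linear_form (coeff_matrix q *v u)"
  have q: "q = f1 * linear_form u"
  proof (rule poly_mapping_eqI)
    fix w
    show "coeff q w = coeff (f1 * linear_form u) w"
    proof (cases "length w = 2")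
      case True
      then obtain i k where w: "w = [i, k]" by (auto simp: length_Suc_conv numeral_2_eq_2)
      have "(coeff_matrix q *v axis k 1) $ i = coeff q [i, k]"
        by (simp add: matrix_vector_mult_basis column_def coeff_matrix_def)
      then show ?thesis
        by (simp add: w f1_def coeff_mult_linear_form coeff_linear_form Q[of "axis k 1"] inner_axis mult.commute)
    next
      case False
      then show ?thesis
        using hom(4) by (cases w rule: rev_cases)
          (auto simp: nc_homogeneous_iff f1_def coeff_mult_linear_form coeff_linear_form split: list.split)
    qed
  qed
  \<comment> \<open>Zero counts as homogeneous of degree one, so this is a separate claim; it holds
    because otherwise nothing of degree three is left.\<close>
  have "f1 \<noteq> 0"
  proof
    assume "f1 = 0"
    then have "p = p0 + p1 + p2" using p q f0 by simp
    moreover obtain w where "length w = 3" "coeff p w \<noteq> 0"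
      using degree_attained[of p] assms(2) by auto
    ultimately show False by (simp add: lookup_add low)
  qed
  moreover have "nc_homogeneous 1 f1"
    by (auto simp: nc_homogeneous_iff f1_def coeff_linear_form split: list.splits)
  ultimately show ?thesis using f0 q by blast
qed

theorem theorem1p3:
  fixes p :: "'g::finite nc_poly" and d :: nat
  assumes "nc_symmetric p"
    and "nc_degree p = d"
  shows "(sigma_minus_min_hessian p \<le> 1 \<longleftrightarrow>
            (\<exists>u p0 p1 p2 q f0. canonical_form p u p0 p1 p2 q f0))
       \<and> (\<forall>u p0 p1 p2 q f0.
            sigma_minus_min_hessian p \<le> 1 \<and> canonical_form p u p0 p1 p2 q f0 \<and> d = 3 \<longrightarrow>
              f0 = 0 \<and> (\<exists>f1. f1 \<noteq> 0 \<and> nc_homogeneous 1 f1 \<and> q = f1 * linear_form u))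
       \<and> (sigma_minus_min_hessian p = 0 \<longleftrightarrow>
            d \<le> 2 \<and>
            (\<forall>n\<ge>1. \<forall>X. (\<forall>j. X j \<in> sym_mats n) \<longrightarrow>
               psd_mat n (nc_eval n X (nc_hom_part 2 p))))"
proof (intro conjI)
  show "sigma_minus_min_hessian p \<le> 1 \<longleftrightarrow> (\<exists>u p0 p1 p2 q f0. canonical_form p u p0 p1 p2 q f0)"
    using canonical_form_of_sigma_le_1[OF assms(1)] sigma_le_1_of_canonical_form by blast
  show "\<forall>u p0 p1 p2 q f0.
      sigma_minus_min_hessian p \<le> 1 \<and> canonical_form p u p0 p1 p2 q f0 \<and> d = 3 \<longrightarrow>
        f0 = 0 \<and> (\<exists>f1. f1 \<noteq> 0 \<and> nc_homogeneous 1 f1 \<and> q = f1 * linear_form u)"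
    using canonical_form_degree_3 assms(2) by blast
  show "sigma_minus_min_hessian p = 0 \<longleftrightarrow> d \<le> 2 \<and>
      (\<forall>n\<ge>1. \<forall>X. (\<forall>j. X j \<in> sym_mats n) \<longrightarrow> psd_mat n (nc_eval n X (nc_hom_part 2 p)))"
  proof
    assume "sigma_minus_min_hessian p = 0"
    then have "0 \<le> hankel p y y" for y by (rule hankel_nonneg_of_sigma_0)
    then show "d \<le> 2 \<and>
        (\<forall>n\<ge>1. \<forall>X. (\<forall>j. X j \<in> sym_mats n) \<longrightarrow> psd_mat n (nc_eval n X (nc_hom_part 2 p)))"
      using degree_le_2_of_hankel_nonneg[OF assms(1)] psd_of_hankel_nonneg[OF assms(1)] assms(2)
        psd_nc_eval[OF hom_part_homogeneous] by blast
  next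
    assume R: "d \<le> 2 \<and>
        (\<forall>n\<ge>1. \<forall>X. (\<forall>j. X j \<in> sym_mats n) \<longrightarrow> psd_mat n (nc_eval n X (nc_hom_part 2 p)))"
    have "psd_matrix (coeff_matrix (nc_hom_part 2 p))"
      using R by (intro psd_coeff_matrix_of_eval hom_part_homogeneous hom_part_symmetric assms(1)) simp
    then show "sigma_minus_min_hessian p = 0"
      using R assms(2) by (intro sigma_0_of_psd) simp_all
  qed
qed

end
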